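(* Let $n\geq5$, let $a_1,\ldots,a_n\in\mathbb{R}$ and $\gamma\in\mathbb{R}$. Let $\mu_X$ be the measure on $\mathbb{R}^n$ given by $d\mu_X=e^{\gamma\sum_{i=1}^{n}a_ix_i}\,dx$, where $dx$ is the Lebesgue measure, and let $b_X=\frac12\big(\sum_{j=1}^n a_j^2\big)^{1/2}$. Then for all complex-valued $f\in C_0^\infty(\mathbb{R}^n\backslash\{0\})$ we have $$\left\|\left(\Delta+\gamma\sum_{i=1}^{n}a_{i}\partial_{x_{i}}\right) f\right\|^{2}_{L^{2}(\mathbb{R}^n,\mu_{X})}\geq\frac{n^2(n-4)^2}{16}\left\|\frac{f}{|x|^{2}}\right\|^{2}_{L^{2}(\mathbb{R}^n,\mu_{X})}+\gamma^{4}b_{X}^{4}\|f\|^{2}_{L^{2}(\mathbb{R}^n,\mu_{X})}+\gamma^{2}b_{X}^{2}\frac{(n-2)^{2}}{2}\left\|\frac{f}{|x|}\right\|^{2}_{L^{2}(\mathbb{R}^n,\mu_{X})}.$$ All the constants are sharp in the sense that there is a sequence of nonzero functions along which equality is attained in the limit (the quotient of the left-hand side by the right-hand side tends to $1$).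
   Context: $\Delta$ is the Euclidean Laplacian on $\mathbb{R}^n$, $|x|$ the Euclidean norm, and $C_0^\infty$ denotes smooth compactly supported functions. *)

theory Defs
  imports "HOL-Analysis.Analysis"
begin

(* The class C^k on S; meant for open S, where "at x" is a derivative along points of S. *)
fun Ck_on :: "nat \<Rightarrow> 'a::real_normed_vector set \<Rightarrow> ('a \<Rightarrow> 'b::real_normed_vector) \<Rightarrow> bool" where
  "Ck_on 0 S f \<longleftrightarrow> continuous_on S f"
| "Ck_on (Suc k) S f \<longleftrightarrow>
     (\<forall>x\<in>S. f differentiable (at x)) \<and> (\<forall>v. Ck_on k S (\<lambda>x. frechet_derivative f (at x) v))"

definition smooth_on :: "'a::real_normed_vector set \<Rightarrow> ('a \<Rightarrow> 'b::real_normed_vector) \<Rightarrow> bool" where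
  "smooth_on S f \<longleftrightarrow> (\<forall>k. Ck_on k S f)"

(* Elements of C_0^infinity(S), S open, are represented by their extension by zero to the
   whole space: the support is closed in the whole space, so it must stay away from the
   boundary of S (for S = -{0}: away from the origin). *)
definition test_functions ::
    "'a::real_normed_vector set \<Rightarrow> ('a \<Rightarrow> 'b::real_normed_vector) set" where
  "test_functions S = {f. smooth_on S f \<and> compact (closure {x. f x \<noteq> 0}) \<and> closure {x. f x \<noteq> 0} \<subseteq> S}"

definition partial_deriv :: "'n::finite \<Rightarrow> (real^'n \<Rightarrow> complex) \<Rightarrow> real^'n \<Rightarrow> complex" where
  "partial_deriv i f x = vector_derivative (\<lambda>t. f (x + t *\<^sub>R axis i 1)) (at 0)"

definition laplacian :: "(real^'n::finite \<Rightarrow> complex) \<Rightarrow> real^'n \<Rightarrow> complex" where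
  "laplacian f x = (\<Sum>i\<in>UNIV. partial_deriv i (partial_deriv i f) x)"

definition drift_laplacian ::
    "real \<Rightarrow> real^'n::finite \<Rightarrow> (real^'n \<Rightarrow> complex) \<Rightarrow> real^'n \<Rightarrow> complex" where
  "drift_laplacian \<gamma> a f x =
     laplacian f x + complex_of_real \<gamma> * (\<Sum>i\<in>UNIV. complex_of_real (a $ i) * partial_deriv i f x)"

definition mu_X :: "real \<Rightarrow> real^'n::finite \<Rightarrow> (real^'n) measure" where
  "mu_X \<gamma> a = density lborel (\<lambda>x. ennreal (exp (\<gamma> * (\<Sum>i\<in>UNIV. a $ i * x $ i))))"

definition b_X :: "real^'n::finite \<Rightarrow> real" where
  "b_X a = 1 / 2 * sqrt (\<Sum>j\<in>UNIV. (a $ j)\<^sup>2)"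

(* Only meaningful for square-integrable f: the Bochner integral is 0 otherwise. *)
definition L2_norm :: "'a measure \<Rightarrow> ('a \<Rightarrow> complex) \<Rightarrow> real" where
  "L2_norm M f = sqrt (\<integral>x. (norm (f x))\<^sup>2 \<partial>M)"

end

theory Submission
  imports Defs
begin

text \<open>
  Put \<open>\<theta> = \<gamma> a / 2\<close> and \<open>g = exp (\<theta> \<bullet> x) f\<close>.  Then \<open>exp (\<theta> \<bullet> x) (\<Delta> + \<gamma> a \<bullet> \<nabla>) f = (\<Delta> - c) g\<close> with
  \<open>c = |\<theta>|\<^sup>2 = \<gamma>\<^sup>2 b\<^sub>X\<^sup>2\<close>, and all weighted norms of \<open>f\<close> become unweighted norms of \<open>g\<close>
  (\<open>weighted_norms_eq_energies\<close>).  Formally,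
  \<open>\<parallel>(\<Delta> - c) g\<parallel>\<^sup>2 = \<parallel>\<Delta>g\<parallel>\<^sup>2 + 2 c \<parallel>\<nabla>g\<parallel>\<^sup>2 + c\<^sup>2 \<parallel>g\<parallel>\<^sup>2\<close>, and the claim is the Rellich inequality for the first term plus
  the Hardy inequality for the second.  Both are obtained at once: with \<open>q = |x|\<^sup>-\<^sup>2\<close> and \<open>m = (n - 4) / 2\<close> the
  difference of the integrands is a sum of squares plus the divergence of an explicit compactly supported
  field (\<open>hardy_rellich_pointwise\<close>), and divergences integrate to zero by translation invariance of
  Lebesgue measure (\<open>integral_deriv_test_function\<close>).  Since the operator has real coefficients, complex functions
  are handled through their real and imaginary parts.

  For sharpness, \<open>|x|\<^sup>-\<^sup>m\<close> is a formal extremal of Rellich's inequality.  The functions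
  \<open>|x|\<^sup>-\<^sup>m \<beta>(ln |x| / N + 2)\<close> with a bump \<open>\<beta>\<close> live on annuli that shrink to the origin, so the terms with
  \<open>c\<close> are negligible, and the cut-off varies on the scale \<open>N\<close> in \<open>ln |x|\<close>, so its derivatives cost only
  \<open>O(1 / N)\<close> (\<open>optimizer_energy_bound\<close>).  Masses of annuli for \<open>|x|\<^sup>-\<^sup>n dx\<close> are compared by dilation
  invariance (\<open>annulus_mass_translate\<close>).  The quotient of the two sides is then squeezed between \<open>1\<close>, by the
  inequality, and an upper bound that tends to \<open>1\<close> (\<open>optimizer_quotient_limit\<close>).
\<close>

section \<open>Calculus of smooth functions\<close>

lemma Ck_on_imp_continuous: "Ck_on k S f \<Longrightarrow> continuous_on S f"
  by (cases k) (auto intro!: continuous_at_imp_continuous_on differentiable_imp_continuous_within)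

lemma Ck_on_Suc_imp: "Ck_on (Suc k) S f \<Longrightarrow> Ck_on k S f"
proof (induction k arbitrary: f)
  case 0
  then show ?case using Ck_on_imp_continuous[of "Suc 0"] by simp
next
  case (Suc k)
  then show ?case by (metis Ck_on.simps(2))
qed

text \<open>The derivative at a point of an open set depends only on the values on that set, and \<^const>\<open>Ck_on\<close>
  looks at nothing else.  This is what allows derivatives to be replaced by explicit formulas that
  are valid only on the open set.\<close>

lemma Ck_on_cong:
  assumes "open S" and "\<And>x. x \<in> S \<Longrightarrow> f x = g x" and "Ck_on k S f"
  shows "Ck_on k S g"
  using assms(2,3)
proof (induction k arbitrary: f g)
  case 0
  then show ?case using continuous_on_cong by (metis Ck_on.simps(1))
next
  case (Suc k)
  have D: "g differentiable (at x) \<and> frechet_derivative f (at x) = frechet_derivative g (at x)"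
    if x: "x \<in> S" for x
  proof -
    have df: "f differentiable (at x)" using Suc.prems x by simp
    from df obtain f' where f': "(f has_derivative f') (at x)" by (auto simp: differentiable_def)
    have "(g has_derivative f') (at x)"
      using has_derivative_transform_within_open[OF f' \<open>open S\<close> x] Suc.prems(1) by blast
    then show ?thesis using f' frechet_derivative_at by (metis differentiable_def)
  qed
  have "Ck_on k S (\<lambda>x. frechet_derivative g (at x) v)" for v
    by (rule Suc.IH[where f="\<lambda>x. frechet_derivative f (at x) v"]) (use D Suc.prems(2) in auto)
  then show ?case using D by simp
qed

lemma Ck_on_Suc_I:
  assumes "open S" and "\<And>x. x \<in> S \<Longrightarrow> (f has_derivative f' x) (at x)"
    and "\<And>v. Ck_on k S (\<lambda>x. f' x v)"
  shows "Ck_on (Suc k) S f"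
proof -
  have "frechet_derivative f (at x) = f' x" if "x \<in> S" for x
    using assms(2)[OF that] frechet_derivative_at by metis
  then have "Ck_on k S (\<lambda>x. frechet_derivative f (at x) v)" for v
    using Ck_on_cong[OF assms(1) _ assms(3)[of v]] by simp
  then show ?thesis using assms(2) by (auto simp: differentiable_def)
qed

lemma Ck_on_Suc_D:
  assumes "Ck_on (Suc k) S f"
  shows "x \<in> S \<Longrightarrow> (f has_derivative frechet_derivative f (at x)) (at x)"
    and "Ck_on k S (\<lambda>x. frechet_derivative f (at x) v)"
  using assms by (auto simp: frechet_derivative_works)

lemma Ck_on_const: "open S \<Longrightarrow> Ck_on k S (\<lambda>x. c)"
proof (induction k arbitrary: c)
  case (Suc k)
  show ?case by (rule Ck_on_Suc_I[where f'="\<lambda>x v. 0"]) (use Suc in auto)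
qed simp

lemma Ck_on_bounded_linear_compose:
  assumes "open S" "bounded_linear h" "Ck_on k S f"
  shows "Ck_on k S (\<lambda>x. h (f x))"
  using assms(3)
proof (induction k arbitrary: f)
  case 0
  then show ?case using assms(2) by (simp add: bounded_linear.continuous_on)
next
  case (Suc k)
  show ?case
    by (rule Ck_on_Suc_I[where f'="\<lambda>x v. h (frechet_derivative f (at x) v)"])
      (use Suc Ck_on_Suc_D[OF Suc.prems] assms in \<open>auto intro: bounded_linear.has_derivative\<close>)
qed

lemma Ck_on_ident: "open S \<Longrightarrow> Ck_on k S (\<lambda>x. x)"
  by (cases k) (auto intro!: Ck_on_Suc_I[where f'="\<lambda>x v. v"] Ck_on_const)

lemma Ck_on_add:
  assumes "open S" "Ck_on k S f" "Ck_on k S g"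
  shows "Ck_on k S (\<lambda>x. f x + g x)"
  using assms(2,3)
proof (induction k arbitrary: f g)
  case 0
  then show ?case by (simp add: continuous_on_add)
next
  case (Suc k)
  note f = Ck_on_Suc_D[OF Suc.prems(1)] and g = Ck_on_Suc_D[OF Suc.prems(2)]
  show ?case
    by (rule Ck_on_Suc_I[where f'="\<lambda>x v. frechet_derivative f (at x) v + frechet_derivative g (at x) v"])
      (use f g Suc.IH assms(1) in \<open>auto intro: has_derivative_add\<close>)
qed

text \<open>In this lemma and the next ones the derivative of the compound function is again built from functions
  of class \<open>k\<close> by the same operations, so that the order of differentiability can be lowered by
  induction.\<close>

lemma Ck_on_mult:
  fixes f g :: "'a::real_normed_vector \<Rightarrow> real"
  assumes "open S" "Ck_on k S f" "Ck_on k S g"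
  shows "Ck_on k S (\<lambda>x. f x * g x)"
  using assms(2,3)
proof (induction k arbitrary: f g)
  case 0
  then show ?case by (simp add: continuous_on_mult)
next
  case (Suc k)
  note f = Ck_on_Suc_D[OF Suc.prems(1)] and g = Ck_on_Suc_D[OF Suc.prems(2)]
  note fk = Ck_on_Suc_imp[OF Suc.prems(1)] and gk = Ck_on_Suc_imp[OF Suc.prems(2)]
  show ?case
    by (rule Ck_on_Suc_I[where f'="\<lambda>x v. f x * frechet_derivative g (at x) v + frechet_derivative f (at x) v * g x"])
      (use f g fk gk Suc.IH assms(1) in \<open>auto intro: has_derivative_mult Ck_on_add\<close>)
qed

lemma Ck_on_compose_real:
  fixes \<phi> :: "real \<Rightarrow> real" and g :: "'a::real_normed_vector \<Rightarrow> real"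
  assumes "open S" "Ck_on k S g" "Ck_on k UNIV \<phi>"
  shows "Ck_on k S (\<lambda>x. \<phi> (g x))"
  using assms(2,3)
proof (induction k arbitrary: \<phi>)
  case 0
  then show ?case using continuous_on_compose2[of UNIV \<phi> S g] by simp
next
  case (Suc k)
  note f = Ck_on_Suc_D[OF Suc.prems(2)] and g = Ck_on_Suc_D[OF Suc.prems(1)]
  note gk = Ck_on_Suc_imp[OF Suc.prems(1)]
  have "Ck_on k S (\<lambda>x. frechet_derivative g (at x) v * frechet_derivative \<phi> (at (g x)) 1)" for v
    by (rule Ck_on_mult[OF assms(1) g(2) Suc.IH[OF gk f(2)]])
  moreover have "((\<lambda>x. \<phi> (g x)) has_derivative
      (\<lambda>v. frechet_derivative g (at x) v * frechet_derivative \<phi> (at (g x)) 1)) (at x)" if "x \<in> S" for x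
  proof -
    have "((\<lambda>x. \<phi> (g x)) has_derivative (\<lambda>v. frechet_derivative \<phi> (at (g x)) (frechet_derivative g (at x) v))) (at x)"
      by (rule has_derivative_compose[OF g(1)[OF that] f(1)[OF UNIV_I]])
    moreover have "linear (frechet_derivative \<phi> (at (g x)))"
      using f(1) has_derivative_linear by blast
    then have "frechet_derivative \<phi> (at (g x)) y = y * frechet_derivative \<phi> (at (g x)) 1" for y
      using linear_cmul[of "frechet_derivative \<phi> (at (g x))" y 1] by simp
    ultimately show ?thesis by (metis (no_types, lifting) ext)
  qed
  ultimately show ?case by (intro Ck_on_Suc_I[OF assms(1)])
qed

lemma Ck_on_Un: "open S \<Longrightarrow> open T \<Longrightarrow> Ck_on k S f \<Longrightarrow> Ck_on k T f \<Longrightarrow> Ck_on k (S \<union> T) f"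
  by (induction k arbitrary: f) (auto intro: continuous_on_open_Un)

lemma inverse_inner_has_derivative:
  fixes x :: "'a::real_inner"
  assumes "x \<noteq> 0"
  shows "((\<lambda>x. inverse (x \<bullet> x)) has_derivative
    (\<lambda>v. - 2 * (x \<bullet> v) * (inverse (x \<bullet> x) * inverse (x \<bullet> x)))) (at x)"
  using assms by (auto intro!: derivative_eq_intros simp: algebra_simps inner_commute)

lemma Ck_on_inverse_inner:
  assumes "0 \<notin> S" "open S"
  shows "Ck_on k S (\<lambda>x::'a::real_inner. inverse (x \<bullet> x))"
proof (induction k)
  case 0
  show ?case using assms by (auto intro!: continuous_intros)
next
  case (Suc k)
  have "((\<lambda>x. inverse (x \<bullet> x)) has_derivative
      (\<lambda>v. (- 2 * (x \<bullet> v)) * (inverse (x \<bullet> x) * inverse (x \<bullet> x)))) (at x)" if "x \<in> S" for x :: 'a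
    by (rule inverse_inner_has_derivative) (use that assms in auto)
  moreover have "Ck_on k S (\<lambda>x. (- 2 * (x \<bullet> v)) * (inverse (x \<bullet> x) * inverse (x \<bullet> x)))" for v :: 'a
  proof -
    have "Ck_on k S (\<lambda>x. x \<bullet> v)"
      using Ck_on_bounded_linear_compose[OF assms(2) bounded_linear_inner_left Ck_on_ident] assms(2) by blast
    then show ?thesis by (intro Ck_on_mult Ck_on_const Suc.IH assms)
  qed
  ultimately show ?case by (rule Ck_on_Suc_I[OF assms(2)])
qed

lemma smooth_on_deriv: "smooth_on S f \<Longrightarrow> smooth_on S (\<lambda>x. frechet_derivative f (at x) v)"
  unfolding smooth_on_def using Ck_on_Suc_D(2) by blast

lemma smooth_on_has_derivative:
  "smooth_on S f \<Longrightarrow> x \<in> S \<Longrightarrow> (f has_derivative frechet_derivative f (at x)) (at x)"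
  unfolding smooth_on_def using Ck_on_Suc_D(1) by blast

lemma smooth_on_imp_continuous: "smooth_on S f \<Longrightarrow> continuous_on S f"
  unfolding smooth_on_def using Ck_on_imp_continuous by blast

lemma smooth_on_const: "open S \<Longrightarrow> smooth_on S (\<lambda>x. c)"
  by (simp add: smooth_on_def Ck_on_const)

lemma smooth_on_ident: "open S \<Longrightarrow> smooth_on S (\<lambda>x. x)"
  by (simp add: smooth_on_def Ck_on_ident)

lemma smooth_on_Un:
  "open S \<Longrightarrow> open T \<Longrightarrow> smooth_on S f \<Longrightarrow> smooth_on T f \<Longrightarrow> smooth_on (S \<union> T) f"
  by (simp add: smooth_on_def Ck_on_Un)

lemma smooth_on_cong:
  "open S \<Longrightarrow> (\<And>x. x \<in> S \<Longrightarrow> f x = g x) \<Longrightarrow> smooth_on S f \<Longrightarrow> smooth_on S g"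
  unfolding smooth_on_def by (intro allI, rule Ck_on_cong[where f=f]) simp_all

lemma smooth_on_bounded_linear_compose:
  "open S \<Longrightarrow> bounded_linear h \<Longrightarrow> smooth_on S f \<Longrightarrow> smooth_on S (\<lambda>x. h (f x))"
  by (simp add: smooth_on_def Ck_on_bounded_linear_compose)

lemma smooth_on_add: "open S \<Longrightarrow> smooth_on S f \<Longrightarrow> smooth_on S g \<Longrightarrow> smooth_on S (\<lambda>x. f x + g x)"
  by (simp add: smooth_on_def Ck_on_add)

lemma smooth_on_inverse_inner: "open S \<Longrightarrow> 0 \<notin> S \<Longrightarrow> smooth_on S (\<lambda>x::'a::real_inner. inverse (x \<bullet> x))"
  by (simp add: smooth_on_def Ck_on_inverse_inner)

lemma smooth_on_mult:
  fixes f g :: "'a::real_normed_vector \<Rightarrow> real"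
  shows "open S \<Longrightarrow> smooth_on S f \<Longrightarrow> smooth_on S g \<Longrightarrow> smooth_on S (\<lambda>x. f x * g x)"
  by (simp add: smooth_on_def Ck_on_mult)

lemma smooth_on_compose_real:
  fixes \<phi> :: "real \<Rightarrow> real" and f :: "'a::real_normed_vector \<Rightarrow> real"
  shows "open S \<Longrightarrow> smooth_on UNIV \<phi> \<Longrightarrow> smooth_on S f \<Longrightarrow> smooth_on S (\<lambda>x. \<phi> (f x))"
  by (simp add: smooth_on_def Ck_on_compose_real)

lemma smooth_on_linear: "open S \<Longrightarrow> bounded_linear h \<Longrightarrow> smooth_on S h"
  by (rule smooth_on_bounded_linear_compose[OF _ _ smooth_on_ident])

lemma smooth_on_derivative_sequence:
  assumes "\<And>j t. (\<phi> j has_real_derivative \<phi> (Suc j) t) (at t)"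
  shows "smooth_on UNIV (\<phi> j)"
proof -
  have "Ck_on k UNIV (\<phi> j)" for k
  proof (induction k arbitrary: j)
    case 0
    show ?case using DERIV_isCont[OF assms] by (auto intro!: continuous_at_imp_continuous_on)
  next
    case (Suc k)
    show ?case
      by (rule Ck_on_Suc_I[where f'="\<lambda>t v. \<phi> (Suc j) t * v"])
        (use assms Suc in \<open>auto simp: has_field_derivative_def intro!: Ck_on_mult[OF open_UNIV] Ck_on_const[OF open_UNIV]\<close>)
  qed
  then show ?thesis by (simp add: smooth_on_def)
qed

lemma smooth_on_exp: "smooth_on UNIV (exp :: real \<Rightarrow> real)"
  using smooth_on_derivative_sequence[of "\<lambda>_. exp"] DERIV_exp by blast

lemma ln_norm_has_derivative:
  fixes x :: "'a::real_inner"
  assumes "x \<noteq> 0"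
  shows "((\<lambda>x. ln (norm x)) has_derivative (\<lambda>v. (x \<bullet> v) * inverse (x \<bullet> x))) (at x)"
proof -
  have "((\<lambda>x. ln (norm x)) has_derivative (\<lambda>v. (sgn x \<bullet> v) / norm x)) (at x)"
    using assms by (auto intro!: derivative_eq_intros has_derivative_norm simp: divide_inverse inner_commute fun_eq_iff)
  moreover have "(\<lambda>v. (sgn x \<bullet> v) / norm x) = (\<lambda>v. (x \<bullet> v) * inverse (x \<bullet> x))"
    by (simp add: sgn_div_norm power2_norm_eq_inner[symmetric] power2_eq_square divide_inverse mult_ac fun_eq_iff)
  ultimately show ?thesis by simp
qed

lemma smooth_on_ln_norm:
  assumes "open S" "0 \<notin> S"
  shows "smooth_on S (\<lambda>x::'a::real_inner. ln (norm x))"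
proof -
  have deriv: "smooth_on S (\<lambda>x::'a. (x \<bullet> v) * inverse (x \<bullet> x))" for v
    by (rule smooth_on_mult[OF assms(1) smooth_on_linear[OF assms(1) bounded_linear_inner_left]
          smooth_on_inverse_inner[OF assms]])
  have "Ck_on (Suc k) S (\<lambda>x::'a. ln (norm x))" for k
    by (rule Ck_on_Suc_I[OF assms(1) ln_norm_has_derivative]) (use deriv assms(2) in \<open>auto simp: smooth_on_def\<close>)
  then show ?thesis unfolding smooth_on_def by (blast intro: Ck_on_Suc_imp)
qed

lemma smooth_on_has_real_derivative:
  assumes "smooth_on UNIV \<phi>"
  shows "(\<phi> has_real_derivative frechet_derivative \<phi> (at t) 1) (at t)"
proof -
  have d: "(\<phi> has_derivative frechet_derivative \<phi> (at t)) (at t)"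
    using smooth_on_has_derivative[OF assms] by blast
  have "frechet_derivative \<phi> (at t) = (*) (frechet_derivative \<phi> (at t) 1)"
  proof
    show "frechet_derivative \<phi> (at t) v = frechet_derivative \<phi> (at t) 1 * v" for v
      using linear_cmul[OF has_derivative_linear[OF d], of v 1] by simp
  qed
  then show "(\<phi> has_real_derivative frechet_derivative \<phi> (at t) 1) (at t)"
    unfolding has_field_derivative_def by (rule subst) (rule d)
qed

section \<open>A smooth bump\<close>

text \<open>The iterated derivatives of \<open>exp (- 1 / t)\<close> for \<open>t > 0\<close> have the form \<open>P\<^sub>j (1 / t) exp (- 1 / t)\<close>
  with polynomials that satisfy \<open>P\<^sub>j\<^sub>+\<^sub>1(y) = y\<^sup>2 (P\<^sub>j(y) - P\<^sub>j'(y))\<close>.\<close>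

fun flat_poly :: "nat \<Rightarrow> real poly" where
  "flat_poly 0 = 1"
| "flat_poly (Suc j) = [:0, 0, 1:] * (flat_poly j - pderiv (flat_poly j))"

definition flat :: "nat \<Rightarrow> real \<Rightarrow> real" where
  "flat j t = (if t > 0 then poly (flat_poly j) (1 / t) * exp (- (1 / t)) else 0)"

lemma poly_times_exp_minus_tendsto_0:
  fixes p :: "real poly"
  shows "((\<lambda>y. poly p y * exp (- y)) \<longlongrightarrow> 0) at_top"
proof -
  have "((\<lambda>y. y ^ k * poly p y * exp (- y)) \<longlongrightarrow> 0) at_top" for k
  proof (induction p arbitrary: k)
    case (pCons a p)
    have "((\<lambda>y. a * (y ^ k / exp y) + y ^ Suc k * poly p y * exp (- y)) \<longlongrightarrow> a * 0 + 0) at_top"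
      by (intro tendsto_intros pCons tendsto_power_div_exp_0)
    then show ?case by (simp add: algebra_simps exp_minus divide_inverse)
  qed simp
  from this[of 0] show ?thesis by simp
qed

text \<open>Only \<open>t = 0\<close> needs an argument: there the difference quotient from the right is
  \<open>y P\<^sub>j(y) exp (- y)\<close> at \<open>y = 1 / h\<close>, and the exponential beats every polynomial.\<close>

lemma flat_has_derivative: "(flat j has_real_derivative flat (Suc j) t) (at t)"
proof -
  consider "t > 0" | "t < 0" | "t = 0" by linarith
  then show ?thesis
  proof cases
    case 1
    have "((\<lambda>t. poly (flat_poly j) (1 / t) * exp (- (1 / t))) has_real_derivative flat (Suc j) t) (at t)"
      using 1 by (auto intro!: derivative_eq_intros DERIV_chain2[OF poly_DERIV]
          simp: flat_def field_simps power2_eq_square)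
    then show ?thesis
      by (rule has_field_derivative_transform_within_open[where S="{0<..}"]) (use 1 in \<open>auto simp: flat_def\<close>)
  next
    case 2
    have "((\<lambda>t. 0) has_real_derivative flat (Suc j) t) (at t)"
      using 2 by (simp add: flat_def)
    then show ?thesis
      by (rule has_field_derivative_transform_within_open[where S="{..<0}"]) (use 2 in \<open>auto simp: flat_def\<close>)
  next
    case 3
    have R: "((\<lambda>h. flat j h / h) \<longlongrightarrow> 0) (at_right 0)"
    proof -
      have "((\<lambda>h. poly ([:0, 1:] * flat_poly j) (inverse h) * exp (- inverse h)) \<longlongrightarrow> 0) (at_right 0)"
        by (rule filterlim_compose[OF poly_times_exp_minus_tendsto_0 filterlim_inverse_at_top_right])
      then show ?thesis
        by (rule Lim_transform_eventually)
          (auto simp: eventually_at_right_field flat_def field_simps intro!: exI[of _ 1])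
    qed
    have L: "((\<lambda>h. flat j h / h) \<longlongrightarrow> 0) (at_left 0)"
      by (rule Lim_transform_eventually[OF tendsto_const])
        (auto simp: eventually_at_left_field flat_def intro!: exI[of _ "-1"])
    from R L have "((\<lambda>h. flat j h / h) \<longlongrightarrow> 0) (at 0)"
      by (simp add: filterlim_split_at)
    then show ?thesis using 3 by (simp add: DERIV_def flat_def)
  qed
qed

definition bump :: "real \<Rightarrow> real" where
  "bump t = flat 0 (1 - t * t)"

lemma smooth_on_bump: "smooth_on UNIV bump"
proof -
  have "smooth_on UNIV (\<lambda>t::real. 1 + (-1) * (t * t))"
    by (intro smooth_on_add smooth_on_mult smooth_on_const smooth_on_ident open_UNIV)
  then have "smooth_on UNIV (\<lambda>t::real. flat 0 (1 + (-1) * (t * t)))"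
    by (rule smooth_on_compose_real[OF open_UNIV smooth_on_derivative_sequence[where \<phi>=flat, OF flat_has_derivative]])
  then show ?thesis by (simp add: bump_def[abs_def])
qed

lemma bump_eq_0: "\<bar>t\<bar> \<ge> 1 \<Longrightarrow> bump t = 0"
proof -
  assume "\<bar>t\<bar> \<ge> 1"
  then have "1 * 1 \<le> \<bar>t\<bar> * \<bar>t\<bar>" by (intro mult_mono) auto
  then show ?thesis by (simp add: bump_def flat_def)
qed

lemma bump_lower_bound: "\<bar>t\<bar> \<le> 1/2 \<Longrightarrow> bump t \<ge> exp (- 2)"
proof -
  assume "\<bar>t\<bar> \<le> 1/2"
  then have "\<bar>t\<bar> * \<bar>t\<bar> \<le> 1/2 * (1/2)" by (intro mult_mono) auto
  then have t: "t * t \<le> 1/4" by simp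
  then have "1 / (1 - t * t) \<le> 2" by (simp add: field_simps)
  then show ?thesis using t by (simp add: bump_def flat_def)
qed

lemma bump_derivatives:
  obtains b1 b2 M where
    "\<And>t. (bump has_real_derivative b1 t) (at t)" "\<And>t. (b1 has_real_derivative b2 t) (at t)"
    "\<And>t. \<bar>b1 t\<bar> \<le> M" "\<And>t. \<bar>b2 t\<bar> \<le> M" "\<And>t. \<bar>t\<bar> > 1 \<Longrightarrow> b1 t = 0" "\<And>t. \<bar>t\<bar> > 1 \<Longrightarrow> b2 t = 0"
proof -
  define b1 where "b1 = (\<lambda>t. frechet_derivative bump (at t) 1)"
  define b2 where "b2 = (\<lambda>t. frechet_derivative b1 (at t) 1)"
  have s1: "smooth_on UNIV b1" unfolding b1_def by (rule smooth_on_deriv[OF smooth_on_bump])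
  have s2: "smooth_on UNIV b2" unfolding b2_def by (rule smooth_on_deriv[OF s1])
  have d1: "(bump has_real_derivative b1 t) (at t)" for t
    unfolding b1_def by (rule smooth_on_has_real_derivative[OF smooth_on_bump])
  have d2: "(b1 has_real_derivative b2 t) (at t)" for t
    unfolding b2_def by (rule smooth_on_has_real_derivative[OF s1])
  have van: "D = 0" if "(h has_real_derivative D) (at t)" "\<And>t. \<bar>t\<bar> > 1 \<Longrightarrow> h t = 0" "\<bar>t\<bar> > 1" for h D and t :: real
  proof -
    have o: "open {t::real. \<bar>t\<bar> > 1}" by (intro open_Collect_less continuous_intros)
    have "(h has_real_derivative 0) (at t)"
      by (rule has_field_derivative_transform_within_open[OF DERIV_const[of 0] o]) (use that in auto)
    then show ?thesis using that(1) DERIV_unique by blast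
  qed
  have z1: "b1 t = 0" if "\<bar>t\<bar> > 1" for t by (rule van[OF d1 _ that]) (simp add: bump_eq_0)
  have z2: "b2 t = 0" if "\<bar>t\<bar> > 1" for t by (rule van[OF d2 _ that]) (simp add: z1)
  have bd: "\<exists>M. \<forall>t. \<bar>h t\<bar> \<le> M" if "smooth_on UNIV h" "\<And>t. \<bar>t\<bar> > 1 \<Longrightarrow> h t = 0" for h :: "real \<Rightarrow> real"
  proof -
    have "compact (h ` {-1..1})"
      using continuous_on_subset[OF smooth_on_imp_continuous[OF that(1)]] by (intro compact_continuous_image) auto
    then obtain M where M: "\<And>t. t \<in> {-1..1} \<Longrightarrow> \<bar>h t\<bar> \<le> M"
      using compact_imp_bounded bounded_iff by (metis image_eqI real_norm_def)
    have "\<bar>h t\<bar> \<le> M" for t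
      using M[of t] M[of 0] that(2)[of t] by (cases "t \<in> {-1..1}") (auto simp: abs_if split: if_splits)
    then show ?thesis by blast
  qed
  obtain M1 M2 where "\<And>t. \<bar>b1 t\<bar> \<le> M1" "\<And>t. \<bar>b2 t\<bar> \<le> M2" using bd[OF s1 z1] bd[OF s2 z2] by blast
  then have "\<bar>b1 t\<bar> \<le> max M1 M2" "\<bar>b2 t\<bar> \<le> max M1 M2" for t by (simp_all add: le_max_iff_disj)
  then show ?thesis using that d1 d2 z1 z2 by blast
qed

section \<open>Test functions\<close>

lemma test_functionsI:
  assumes "smooth_on S g" "compact K" "K \<subseteq> S" "\<And>x. x \<notin> K \<Longrightarrow> g x = 0"
  shows "g \<in> test_functions S"
proof -
  have sub: "closure {x. g x \<noteq> 0} \<subseteq> K"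
    using assms by (intro closure_minimal compact_imp_closed) auto
  then have "closure {x. g x \<noteq> 0} = K \<inter> closure {x. g x \<noteq> 0}" by auto
  then have "compact (closure {x. g x \<noteq> 0})"
    using compact_Int_closed[OF assms(2) closed_closure] by metis
  then show ?thesis using assms(1,3) sub by (simp add: test_functions_def)
qed

lemma test_functionsE:
  assumes "f \<in> test_functions S"
  obtains K where "smooth_on S f" "compact K" "K \<subseteq> S" "\<And>x. x \<notin> K \<Longrightarrow> f x = 0"
  using assms that[of "closure {x. f x \<noteq> 0}"] closure_subset[of "{x. f x \<noteq> 0}"]
  unfolding test_functions_def by blast

text \<open>A test function vanishes on the open complement of its support, so its smoothness on \<open>S\<close> extends to
  the whole space; in particular the singular point of a punctured space is harmless.\<close>

lemma test_function_smooth_UNIV: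
  assumes "open S" "f \<in> test_functions S"
  shows "smooth_on UNIV f"
proof -
  obtain K where K: "smooth_on S f" "compact K" "K \<subseteq> S" "\<And>x. x \<notin> K \<Longrightarrow> f x = 0"
    using assms(2) test_functionsE by blast
  have o: "open (- K)" using K(2) by (simp add: compact_imp_closed open_Compl)
  have "smooth_on (- K) f"
    by (rule smooth_on_cong[OF o _ smooth_on_const[OF o, of 0]]) (simp add: K(4))
  from smooth_on_Un[OF assms(1) o K(1) this] have "smooth_on (S \<union> - K) f" .
  moreover have "S \<union> - K = UNIV" using K(3) by auto
  ultimately show ?thesis by simp
qed

lemma test_function_bounded_linear:
  assumes "open S" "bounded_linear h" "f \<in> test_functions S"
  shows "(\<lambda>x. h (f x)) \<in> test_functions S"
proof -
  obtain K where K: "smooth_on S f" "compact K" "K \<subseteq> S" "\<And>x. x \<notin> K \<Longrightarrow> f x = 0"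
    using assms(3) test_functionsE by blast
  show ?thesis
  proof (rule test_functionsI[OF _ K(2,3)])
    show "smooth_on S (\<lambda>x. h (f x))" by (rule smooth_on_bounded_linear_compose[OF assms(1,2) K(1)])
    show "h (f x) = 0" if "x \<notin> K" for x
      using that K(4)[of x] linear_0[OF bounded_linear.linear[OF assms(2)]] by metis
  qed
qed

lemma test_function_mult:
  fixes f g :: "'a::real_normed_vector \<Rightarrow> real"
  assumes "open S" "f \<in> test_functions S" "smooth_on S g"
  shows "(\<lambda>x. f x * g x) \<in> test_functions S"
proof -
  obtain K where K: "smooth_on S f" "compact K" "K \<subseteq> S" "\<And>x. x \<notin> K \<Longrightarrow> f x = 0"
    using assms(2) test_functionsE by blast
  then show ?thesis
    using assms by (intro test_functionsI[of S _ K] smooth_on_mult) auto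
qed

lemma test_function_add:
  assumes "open S" "f \<in> test_functions S" "g \<in> test_functions S"
  shows "(\<lambda>x. f x + g x) \<in> test_functions S"
proof -
  obtain K where K: "smooth_on S f" "compact K" "K \<subseteq> S" "\<And>x. x \<notin> K \<Longrightarrow> f x = 0"
    using assms(2) test_functionsE by blast
  obtain L where L: "smooth_on S g" "compact L" "L \<subseteq> S" "\<And>x. x \<notin> L \<Longrightarrow> g x = 0"
    using assms(3) test_functionsE by blast
  show ?thesis
    using assms K L by (intro test_functionsI[of S _ "K \<union> L"] smooth_on_add) auto
qed

lemma test_function_sum:
  assumes "open S" "finite I" "\<And>i. i \<in> I \<Longrightarrow> f i \<in> test_functions S"
  shows "(\<lambda>x. \<Sum>i\<in>I. f i x) \<in> test_functions S"
  using assms(2,3)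
proof (induction I)
  case empty
  show ?case by (rule test_functionsI[of S _ "{}"]) (auto intro: smooth_on_const assms)
next
  case (insert i I)
  then show ?case using test_function_add[OF assms(1), of "f i" "\<lambda>x. \<Sum>i\<in>I. f i x"] by simp
qed

lemma test_function_deriv:
  assumes "open S" "f \<in> test_functions S"
  shows "(\<lambda>x. frechet_derivative f (at x) v) \<in> test_functions S"
proof -
  obtain K where K: "smooth_on S f" "compact K" "K \<subseteq> S" "\<And>x. x \<notin> K \<Longrightarrow> f x = 0"
    using assms(2) test_functionsE by blast
  have "frechet_derivative f (at x) v = 0" if "x \<notin> K" for x
  proof -
    have o: "open (- K)" using K(2) by (simp add: compact_imp_closed open_Compl)
    have "(f has_derivative (\<lambda>v. 0)) (at x)"
      by (rule has_derivative_transform_within_open[OF has_derivative_const[of 0] o]) (use that K(4) in auto)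
    then show ?thesis using frechet_derivative_at by metis
  qed
  then show ?thesis using K by (intro test_functionsI[of S _ K] smooth_on_deriv) auto
qed

lemma integrable_test_function:
  fixes f :: "'a::euclidean_space \<Rightarrow> 'b::euclidean_space"
  assumes "open S" "f \<in> test_functions S"
  shows "integrable lborel f"
proof -
  obtain K where K: "smooth_on S f" "compact K" "K \<subseteq> S" "\<And>x. x \<notin> K \<Longrightarrow> f x = 0"
    using assms(2) test_functionsE by blast
  have "integrable lborel (\<lambda>x. indicator K x *\<^sub>R f x)"
    using K(1,3) by (intro borel_integrable_compact K(2)) (blast intro: continuous_on_subset smooth_on_imp_continuous)
  moreover have "(\<lambda>x. indicator K x *\<^sub>R f x) = f" using K(4) by (auto simp: indicator_def fun_eq_iff)
  ultimately show ?thesis by simp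
qed

text \<open>A form of the divergence theorem.  By translation invariance the integral of
  every difference quotient \<open>(V (x + h v) - V x) / h\<close> vanishes.  These quotients converge
  to the derivative along \<open>v\<close>; for \<open>0 < h \<le> 1\<close> they are supported in a common compact set and, by the mean value
  theorem, uniformly bounded, so dominated convergence applies.\<close>

lemma integral_deriv_test_function:
  fixes V :: "'a::euclidean_space \<Rightarrow> real"
  assumes "open S" "V \<in> test_functions S"
  shows "(\<integral>x. frechet_derivative V (at x) v \<partial>lborel) = 0"
proof -
  define W where "W = (\<lambda>x. frechet_derivative V (at x) v)"
  define h where "h k = inverse (real (Suc k))" for k
  define s where "s k x = (V (h k *\<^sub>R v + x) - V x) / h k" for k x
  have h: "0 < h k" "h k \<le> 1" for k by (auto simp: h_def field_simps)
  obtain K where "smooth_on S V" and K: "compact K" and "K \<subseteq> S" and K0: "\<And>x. x \<notin> K \<Longrightarrow> V x = 0"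
    using assms(2) test_functionsE by blast
  have W: "W \<in> test_functions S" unfolding W_def by (rule test_function_deriv[OF assms])
  obtain L where L: "smooth_on S W" "compact L" "L \<subseteq> S" "\<And>x. x \<notin> L \<Longrightarrow> W x = 0"
    using W test_functionsE by blast
  have "compact (W ` L)"
    using L by (intro compact_continuous_image) (blast intro: continuous_on_subset smooth_on_imp_continuous)
  then obtain M where M: "\<And>x. x \<in> L \<Longrightarrow> \<bar>W x\<bar> \<le> M"
    using compact_imp_bounded bounded_iff by (metis image_eqI real_norm_def)
  have M: "\<bar>W x\<bar> \<le> \<bar>M\<bar>" for x
    using M[of x] L(4)[of x] by (cases "x \<in> L") auto
  define K' where "K' = (\<lambda>(t, x). x + (- t) *\<^sub>R v) ` ({0..1} \<times> K)"
  have K': "compact K'"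
    unfolding K'_def case_prod_beta
    by (intro compact_continuous_image compact_Times K compact_Icc continuous_intros)
  have line: "((\<lambda>t. V (t *\<^sub>R v + x)) has_real_derivative W (t *\<^sub>R v + x)) (at t)" for t x
  proof -
    have d: "(V has_derivative frechet_derivative V (at (t *\<^sub>R v + x))) (at (t *\<^sub>R v + x))"
      by (rule smooth_on_has_derivative[OF test_function_smooth_UNIV[OF assms] UNIV_I])
    have "((\<lambda>t. V (t *\<^sub>R v + x)) has_derivative (\<lambda>r. frechet_derivative V (at (t *\<^sub>R v + x)) (r *\<^sub>R v))) (at t)"
      by (rule has_derivative_compose[where f="\<lambda>t. t *\<^sub>R v + x", OF _ d]) (auto intro!: derivative_eq_intros)
    moreover have "frechet_derivative V (at (t *\<^sub>R v + x)) (r *\<^sub>R v) = W (t *\<^sub>R v + x) * r" for r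
      using linear_cmul[OF has_derivative_linear[OF d], of r v] by (simp add: W_def)
    ultimately show ?thesis by (simp add: has_field_derivative_def)
  qed
  have lim: "(\<lambda>k. s k x) \<longlonglongrightarrow> W x" for x
  proof -
    have "((\<lambda>t. (V (t *\<^sub>R v + x) - V x) / t) \<longlongrightarrow> W x) (at 0)"
      using line[of x 0] by (simp add: DERIV_def)
    moreover have "filterlim h (at 0) sequentially"
      unfolding filterlim_at using h(1) LIMSEQ_inverse_real_of_nat
      by (auto simp: h_def[abs_def] intro!: always_eventually)
    ultimately show ?thesis unfolding s_def by (rule filterlim_compose)
  qed
  have bound: "norm (s k x) \<le> indicator K' x * \<bar>M\<bar>" for k x
  proof (cases "x \<in> K'")
    case False
    have "x \<notin> K" using False unfolding K'_def by (force intro: rev_image_eqI[of "(0, x)"])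
    moreover have "h k *\<^sub>R v + x \<notin> K"
    proof
      assume "h k *\<^sub>R v + x \<in> K"
      then have "x \<in> K'" using h[of k] unfolding K'_def
        by (intro rev_image_eqI[of "(h k, h k *\<^sub>R v + x)"]) (auto intro: less_imp_le)
      then show False using False by simp
    qed
    ultimately show ?thesis using K0 False by (simp add: s_def)
  next
    case True
    obtain z where "V (h k *\<^sub>R v + x) - V (0 *\<^sub>R v + x) = (h k - 0) * W (z *\<^sub>R v + x)"
      using MVT2[of 0 "h k" "\<lambda>t. V (t *\<^sub>R v + x)" "\<lambda>t. W (t *\<^sub>R v + x)"] line h(1)[of k] by blast
    then have "s k x = W (z *\<^sub>R v + x)" using h(1)[of k] by (simp add: s_def field_simps)
    then show ?thesis using True M by simp
  qed
  have iV: "integrable lborel V" by (rule integrable_test_function[OF assms])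
  have shift: "integrable lborel (\<lambda>x. V (c + x)) \<and> (\<integral>x. V (c + x) \<partial>lborel) = (\<integral>x. V x \<partial>lborel)" for c
  proof -
    have m: "V \<in> borel_measurable borel" using iV by simp
    have "integrable (distr lborel borel ((+) c)) V" using iV by (simp add: lborel_distr_plus)
    moreover have "integral\<^sup>L (distr lborel borel ((+) c)) V = (\<integral>x. V x \<partial>lborel)" by (simp add: lborel_distr_plus)
    ultimately show ?thesis using m by (simp add: integrable_distr_eq integral_distr)
  qed
  have zero: "(\<integral>x. s k x \<partial>lborel) = 0" for k
    using shift[of "h k *\<^sub>R v"] iV by (simp add: s_def)
  have iM: "integrable lborel (\<lambda>x. indicator K' x * \<bar>M\<bar>)"
    using borel_integrable_compact[OF K', of "\<lambda>x. \<bar>M\<bar>"] by simp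
  have "(\<lambda>k. \<integral>x. s k x \<partial>lborel) \<longlonglongrightarrow> (\<integral>x. W x \<partial>lborel)"
  proof (rule integral_dominated_convergence[OF _ _ iM])
    show "W \<in> borel_measurable lborel"
      using integrable_test_function[OF assms(1) W] by simp
    show "s k \<in> borel_measurable lborel" for k
      unfolding s_def using shift[of "h k *\<^sub>R v"] iV by (intro borel_measurable_divide borel_measurable_diff) auto
  qed (use lim bound in auto)
  then show ?thesis using zero by (simp add: W_def LIMSEQ_const_iff)
qed

section \<open>The Hardy-Rellich inequality without weight\<close>

definition pd :: "'n::finite \<Rightarrow> (real^'n \<Rightarrow> real) \<Rightarrow> real^'n \<Rightarrow> real" where
  "pd i g x = frechet_derivative g (at x) (axis i 1)"

definition lap :: "(real^'n::finite \<Rightarrow> real) \<Rightarrow> real^'n \<Rightarrow> real" where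
  "lap g x = (\<Sum>i\<in>UNIV. pd i (pd i g) x)"

lemma pd_eqI: "(g has_derivative D) (at x) \<Longrightarrow> pd i g x = D (axis i 1)"
  unfolding pd_def using frechet_derivative_at by metis

lemma open_punctured: "open (- {0::real^'n::finite})"
  by auto

lemma pd_test_function: "open S \<Longrightarrow> g \<in> test_functions S \<Longrightarrow> pd i g \<in> test_functions S"
  unfolding pd_def[abs_def] by (rule test_function_deriv)

lemma lap_test_function: "open S \<Longrightarrow> g \<in> test_functions S \<Longrightarrow> lap g \<in> test_functions S"
  unfolding lap_def[abs_def] by (intro test_function_sum pd_test_function) auto

lemma test_function_has_derivative:
  "open S \<Longrightarrow> g \<in> test_functions S \<Longrightarrow> (g has_derivative frechet_derivative g (at x)) (at x)"
  by (rule smooth_on_has_derivative[OF test_function_smooth_UNIV UNIV_I])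

lemma test_function_cmult:
  fixes f :: "'a::real_normed_vector \<Rightarrow> real"
  shows "open S \<Longrightarrow> f \<in> test_functions S \<Longrightarrow> (\<lambda>x. c * f x) \<in> test_functions S"
  using test_function_bounded_linear[OF _ bounded_linear_mult_right] .

lemma smooth_on_component: "open S \<Longrightarrow> smooth_on S (\<lambda>x::real^'n::finite. x $ i)"
  by (rule smooth_on_linear[OF _ bounded_linear_vec_nth])

lemma test_function_smooth: "f \<in> test_functions S \<Longrightarrow> smooth_on S f"
  by (simp add: test_functions_def)

text \<open>The two sides of the inequality after removal of the exponential weight.  The dimension enters through
  \<open>m = (n - 4) / 2\<close>, so that \<open>m (m + 2) = n (n - 4) / 4\<close> is the Rellich constant and
  \<open>m + 1 = (n - 2) / 2\<close> the Hardy constant; \<open>c\<close> stands for \<open>\<gamma>\<^sup>2 b\<^sub>X\<^sup>2\<close>.\<close>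

definition operator_energy :: "real \<Rightarrow> (real^'n::finite \<Rightarrow> real) \<Rightarrow> real" where
  "operator_energy c g = (\<integral>x. (lap g x - c * g x)\<^sup>2 \<partial>lborel)"

definition hardy_energy :: "real \<Rightarrow> real \<Rightarrow> (real^'n::finite \<Rightarrow> real) \<Rightarrow> real" where
  "hardy_energy m c g = (m * (m + 2))\<^sup>2 * (\<integral>x. (g x * inverse (x \<bullet> x))\<^sup>2 \<partial>lborel)
     + c\<^sup>2 * (\<integral>x. (g x)\<^sup>2 \<partial>lborel) + 2 * c * (m + 1)\<^sup>2 * (\<integral>x. (g x)\<^sup>2 * inverse (x \<bullet> x) \<partial>lborel)"

lemma integrable_energies:
  assumes g: "g \<in> test_functions (- {0::real^'n::finite})"
  shows "integrable lborel (\<lambda>x. (g x * inverse (x \<bullet> x))\<^sup>2)" "integrable lborel (\<lambda>x. (g x)\<^sup>2)"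
    "integrable lborel (\<lambda>x. (g x)\<^sup>2 * inverse (x \<bullet> x))" "integrable lborel (\<lambda>x. (lap g x - c * g x)\<^sup>2)"
proof -
  note o = open_punctured[where 'n='n]
  note sg = test_function_smooth[OF g]
  have sq: "smooth_on (- {0}) (\<lambda>x::real^'n. inverse (x \<bullet> x))" by (rule smooth_on_inverse_inner[OF o]) simp
  have "(\<lambda>x. (g x * inverse (x \<bullet> x))\<^sup>2) \<in> test_functions (- {0})"
    unfolding power2_eq_square by (intro test_function_mult o g sg sq smooth_on_mult)
  moreover have T2: "(\<lambda>x. (g x)\<^sup>2) \<in> test_functions (- {0})"
    unfolding power2_eq_square by (intro test_function_mult o g sg sq smooth_on_mult)
  moreover have "(\<lambda>x. (g x)\<^sup>2 * inverse (x \<bullet> x)) \<in> test_functions (- {0})"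
    by (intro test_function_mult o T2 sq)
  moreover have "(\<lambda>x. lap g x + (- c) * g x) \<in> test_functions (- {0})"
    by (intro test_function_add lap_test_function test_function_cmult o g)
  then have "(\<lambda>x. (lap g x - c * g x)\<^sup>2) \<in> test_functions (- {0})"
    using test_function_mult[OF o _ test_function_smooth] by (fastforce simp: power2_eq_square)
  ultimately show "integrable lborel (\<lambda>x. (g x * inverse (x \<bullet> x))\<^sup>2)" "integrable lborel (\<lambda>x. (g x)\<^sup>2)"
    "integrable lborel (\<lambda>x. (g x)\<^sup>2 * inverse (x \<bullet> x))" "integrable lborel (\<lambda>x. (lap g x - c * g x)\<^sup>2)"
    using integrable_test_function[OF o] by blast+
qed

text \<open>A vector field whose divergence compensates the cross terms of the three completed squares in the next
  lemma.  With \<open>q = |x|\<^sup>-\<^sup>2\<close> and \<open>K = m (m + 2)\<close> its terms are those that integration by parts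
  produces from \<open>- 2 c g \<Delta>g\<close>, from \<open>- 2 K q g \<Delta>g\<close>, and from the Hardy inequalities with the weights
  \<open>1\<close> and \<open>q\<close>.\<close>

definition hardy_field :: "real \<Rightarrow> real \<Rightarrow> (real^'n::finite \<Rightarrow> real) \<Rightarrow> 'n \<Rightarrow> real^'n \<Rightarrow> real" where
  "hardy_field m c g i x =
     (g x * pd i g x) * ((- 2 * c) + (- 2 * (m * (m + 2))) * inverse (x \<bullet> x))
     + (g x * g x) * (x $ i * ((- 2 * c * (m + 1)) * inverse (x \<bullet> x)
         + (- 2 * (m * (m + 2)) * (m + 1)) * (inverse (x \<bullet> x) * inverse (x \<bullet> x))))"

text \<open>Hardy's and Rellich's inequalities in one stroke.  Up to the divergence of \<^const>\<open>hardy_field\<close>, the right-hand side is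
  the sum of squares
  \<open>(\<Delta>g + K q g)\<^sup>2 + 2 c |\<nabla>g + (m + 1) q g x|\<^sup>2 + 2 K q |\<nabla>g + m q g x|\<^sup>2\<close>,
  as one sees by expanding and using \<open>q |x|\<^sup>2 = 1\<close>.\<close>

lemma hardy_rellich_pointwise:
  fixes g :: "real^'n::finite \<Rightarrow> real" and c m :: real
  defines "q \<equiv> \<lambda>x::real^'n. inverse (x \<bullet> x)"
  defines "K \<equiv> m * (m + 2)"
  assumes g: "g \<in> test_functions (- {0})" and m: "real CARD('n) = 2 * m + 4" "m \<ge> 0" and c: "c \<ge> 0"
  shows "(\<Sum>i\<in>UNIV. pd i (hardy_field m c g i) x) \<le> (lap g x - c * g x)\<^sup>2
     - (K\<^sup>2 * (g x * q x)\<^sup>2 + c\<^sup>2 * (g x)\<^sup>2 + 2 * c * (m + 1)\<^sup>2 * ((g x)\<^sup>2 * q x))"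
proof -
  define V where "V = hardy_field m c g"
  have V_def': "V = (\<lambda>i x. (g x * pd i g x) * ((- 2 * c) + (- 2 * K) * q x)
      + (g x * g x) * (x $ i * ((- 2 * c * (m + 1)) * q x + (- 2 * K * (m + 1)) * (q x * q x))))"
    unfolding V_def hardy_field_def[abs_def] q_def K_def ..
  have "(\<Sum>i\<in>UNIV. pd i (V i) x) \<le> (lap g x - c * g x)\<^sup>2
     - (K\<^sup>2 * (g x * q x)\<^sup>2 + c\<^sup>2 * (g x)\<^sup>2 + 2 * c * (m + 1)\<^sup>2 * ((g x)\<^sup>2 * q x))"
  proof (cases "x = 0")
    case True
    obtain L where "smooth_on (- {0}) g" and L: "compact L" "L \<subseteq> - {0}" and 0: "\<And>x. x \<notin> L \<Longrightarrow> g x = 0"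
      using g test_functionsE by blast
    have o: "open (- L)" using L by (simp add: compact_imp_closed open_Compl)
    \<comment> \<open>At the origin, where \<open>q\<close> has the default value \<open>0\<close>, everything vanishes together with \<open>g\<close>.\<close>
    have z: "pd i (V i) 0 = 0" for i
    proof -
      have "(V i has_derivative (\<lambda>v. 0)) (at 0)"
        by (rule has_derivative_transform_within_open[OF has_derivative_const[of 0] o])
          (use L 0 in \<open>auto simp: V_def'\<close>)
      then show ?thesis by (rule pd_eqI)
    qed
    have "g 0 = 0" using 0 L by blast
    then show ?thesis using True by (simp add: z)
  next
    case False
    define R where "R = (\<Sum>i\<in>UNIV. (x $ i)\<^sup>2)"
    define N where "N = (\<Sum>i\<in>UNIV. (pd i g x)\<^sup>2)"
    define E where "E = (\<Sum>i\<in>UNIV. x $ i * pd i g x)"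
    have R: "x \<bullet> x = R" by (simp add: R_def inner_vec_def power2_eq_square)
    have R1: "q x * R = 1" unfolding R[symmetric] q_def using False by simp
    have q0: "q x \<ge> 0" by (simp add: q_def)
    have K0: "K \<ge> 0" using m by (simp add: K_def)
    note dg = test_function_has_derivative[OF open_punctured g]
    note dp = test_function_has_derivative[OF open_punctured pd_test_function[OF open_punctured g]]
    have dq: "(q has_derivative (\<lambda>v. - 2 * (x \<bullet> v) * (q x * q x))) (at x)"
      unfolding q_def by (rule inverse_inner_has_derivative[OF False])
    have V': "pd i (V i) x = (- 2 * c - 2 * K * q x) * (pd i g x)\<^sup>2
       + ((- 2 * c - 2 * K * q x) * g x) * pd i (pd i g) x
       + (4 * K * (q x)\<^sup>2 * g x + 2 * g x * ((- 2 * c * (m + 1)) * q x + (- 2 * K * (m + 1)) * (q x)\<^sup>2)) * (x $ i * pd i g x)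
       + (g x)\<^sup>2 * ((- 2 * c * (m + 1)) * q x + (- 2 * K * (m + 1)) * (q x)\<^sup>2)
       + ((g x)\<^sup>2 * (4 * c * (m + 1) * (q x)\<^sup>2 + 8 * K * (m + 1) * (q x)^3)) * (x $ i)\<^sup>2" for i
      unfolding V_def'
      by (subst pd_eqI[OF has_derivative_add[OF
            has_derivative_mult[OF has_derivative_mult[OF dg dp]
              has_derivative_add[OF has_derivative_const has_derivative_mult[OF has_derivative_const dq]]]
            has_derivative_mult[OF has_derivative_mult[OF dg dg]
              has_derivative_mult[OF bounded_linear.has_derivative[OF bounded_linear_vec_nth has_derivative_ident]
                has_derivative_add[OF has_derivative_mult[OF has_derivative_const dq]
                 has_derivative_mult[OF has_derivative_const has_derivative_mult[OF dq dq]]]]]]])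
        (simp add: pd_def[symmetric] inner_axis algebra_simps power2_eq_square power3_eq_cube)
    have S: "(\<Sum>i\<in>UNIV. pd i (V i) x) = (- 2 * c - 2 * K * q x) * N
       + ((- 2 * c - 2 * K * q x) * g x) * lap g x
       + (4 * K * (q x)\<^sup>2 * g x + 2 * g x * ((- 2 * c * (m + 1)) * q x + (- 2 * K * (m + 1)) * (q x)\<^sup>2)) * E
       + (2 * m + 4) * ((g x)\<^sup>2 * ((- 2 * c * (m + 1)) * q x + (- 2 * K * (m + 1)) * (q x)\<^sup>2))
       + ((g x)\<^sup>2 * (4 * c * (m + 1) * (q x)\<^sup>2 + 8 * K * (m + 1) * (q x)^3)) * R"
      unfolding V' sum.distrib N_def E_def R_def lap_def m(1)[symmetric] sum_distrib_left[symmetric]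
      by (simp add: algebra_simps)
    have sq: "(\<Sum>i\<in>UNIV. (pd i g x + k * (x $ i))\<^sup>2) = N + 2 * k * E + k\<^sup>2 * R" for k
    proof -
      have "(pd i g x + k * (x $ i))\<^sup>2 = (pd i g x)\<^sup>2 + (2 * k) * (x $ i * pd i g x) + k\<^sup>2 * (x $ i)\<^sup>2" for i
        by (simp add: power2_eq_square algebra_simps)
      then show ?thesis by (simp only: sum.distrib N_def E_def R_def sum_distrib_left[symmetric])
    qed
    \<comment> \<open>The constants \<open>m + 1\<close> and \<open>m\<close> are the optimal ones in the Hardy inequalities with weights \<open>1\<close> and
      \<open>q\<close>; \<open>K\<close> completes the square in the Rellich step.\<close>
    have "0 \<le> (lap g x + K * g x * q x)\<^sup>2
        + 2 * c * (\<Sum>i\<in>UNIV. (pd i g x + ((m + 1) * g x * q x) * (x $ i))\<^sup>2)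
        + 2 * K * q x * (\<Sum>i\<in>UNIV. (pd i g x + (m * g x * q x) * (x $ i))\<^sup>2)"
      using q0 K0 c by (intro add_nonneg_nonneg mult_nonneg_nonneg sum_nonneg) auto
    also have "\<dots> = (lap g x - c * g x)\<^sup>2
       - (K\<^sup>2 * (g x * q x)\<^sup>2 + c\<^sup>2 * (g x)\<^sup>2 + 2 * c * (m + 1)\<^sup>2 * ((g x)\<^sup>2 * q x))
       - (\<Sum>i\<in>UNIV. pd i (V i) x)"
      unfolding S sq using R1 unfolding K_def by algebra
    finally show ?thesis by simp
  qed
  then show ?thesis by (simp add: V_def)
qed

text \<open>Integration of the pointwise inequality; the divergence on its left-hand side has integral \<open>0\<close>.\<close>

theorem hardy_rellich_real:
  fixes g :: "real^'n::finite \<Rightarrow> real" and c m :: real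
  assumes g: "g \<in> test_functions (- {0})" and m: "real CARD('n) = 2 * m + 4" "m \<ge> 0" and c: "c \<ge> 0"
  shows "hardy_energy m c g \<le> operator_energy c g"
proof -
  note o = open_punctured[where 'n='n]
  note sg = test_function_smooth[OF g]
  note I = integrable_energies[OF g]
  let ?V = "hardy_field m c g"
  have sq: "smooth_on (- {0}) (\<lambda>x::real^'n. inverse (x \<bullet> x))"
    by (rule smooth_on_inverse_inner[OF o]) simp
  have V: "?V i \<in> test_functions (- {0})" for i
    unfolding hardy_field_def[abs_def]
    by (intro test_function_add test_function_mult smooth_on_add smooth_on_mult smooth_on_const sq
        smooth_on_component g o test_function_smooth[OF pd_test_function[OF o g]] sg)
  have iV: "integrable lborel (pd i (?V i))" for i
    by (rule integrable_test_function[OF o pd_test_function[OF o V]])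
  let ?h = "\<lambda>x. (m * (m + 2))\<^sup>2 * (g x * inverse (x \<bullet> x))\<^sup>2 + c\<^sup>2 * (g x)\<^sup>2
      + 2 * c * (m + 1)\<^sup>2 * ((g x)\<^sup>2 * inverse (x \<bullet> x))"
  have ih: "integrable lborel ?h"
    by (intro Bochner_Integration.integrable_add integrable_mult_right I)
  have "(\<integral>x. pd i (?V i) x \<partial>lborel) = 0" for i
    unfolding pd_def by (rule integral_deriv_test_function[OF o V])
  then have "0 = (\<integral>x. (\<Sum>i\<in>UNIV. pd i (?V i) x) \<partial>lborel)"
    using iV by simp
  also have "\<dots> \<le> (\<integral>x. (lap g x - c * g x)\<^sup>2 - ?h x \<partial>lborel)"
  proof (rule integral_mono)
    show "integrable lborel (\<lambda>x. \<Sum>i\<in>UNIV. pd i (?V i) x)" using iV by simp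
    show "integrable lborel (\<lambda>x. (lap g x - c * g x)\<^sup>2 - ?h x)"
      by (intro Bochner_Integration.integrable_diff I ih)
    show "(\<Sum>i\<in>UNIV. pd i (?V i) x) \<le> (lap g x - c * g x)\<^sup>2 - ?h x" for x
      by (rule hardy_rellich_pointwise[OF g m c])
  qed
  also have "\<dots> = operator_energy c g - hardy_energy m c g"
    unfolding operator_energy_def hardy_energy_def using I ih by simp
  finally show ?thesis by simp
qed

section \<open>Removal of the weight\<close>

lemma exp_inner_has_derivative:
  "((\<lambda>x::'a::real_inner. exp (\<theta> \<bullet> x)) has_derivative (\<lambda>v. exp (\<theta> \<bullet> x) * (\<theta> \<bullet> v))) (at x)"
  by (auto intro!: derivative_eq_intros)

lemma smooth_on_exp_inner: "open S \<Longrightarrow> smooth_on S (\<lambda>x::'a::real_inner. exp (\<theta> \<bullet> x))"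
  by (rule smooth_on_compose_real[OF _ smooth_on_exp smooth_on_linear[OF _ bounded_linear_inner_right]])

lemma pd_exp_mult:
  assumes "smooth_on UNIV u"
  shows "pd i (\<lambda>x. exp (\<theta> \<bullet> x) * u x) = (\<lambda>x. exp (\<theta> \<bullet> x) * (pd i u x + \<theta> $ i * u x))"
proof
  fix x
  show "pd i (\<lambda>x. exp (\<theta> \<bullet> x) * u x) x = exp (\<theta> \<bullet> x) * (pd i u x + \<theta> $ i * u x)"
    by (subst pd_eqI[OF has_derivative_mult[OF exp_inner_has_derivative smooth_on_has_derivative[OF assms UNIV_I]]])
      (simp add: pd_def inner_axis algebra_simps)
qed

text \<open>The first-order terms created by the product rule are exactly a drift along \<open>2 \<theta>\<close>, so conjugation by
  \<open>exp (\<theta> \<bullet> x)\<close> trades the drift for the zeroth-order term \<open>- |\<theta>|\<^sup>2\<close>.\<close>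

lemma lap_exp_mult:
  assumes u: "smooth_on UNIV u"
  shows "lap (\<lambda>x. exp (\<theta> \<bullet> x) * u x) x - (\<theta> \<bullet> \<theta>) * (exp (\<theta> \<bullet> x) * u x)
     = exp (\<theta> \<bullet> x) * (lap u x + 2 * (\<Sum>i\<in>UNIV. \<theta> $ i * pd i u x))"
proof -
  have pu: "smooth_on UNIV (pd i u)" for i
    unfolding pd_def[abs_def] by (rule smooth_on_deriv[OF u])
  have s: "smooth_on UNIV (\<lambda>x. pd i u x + \<theta> $ i * u x)" for i
    by (intro smooth_on_add smooth_on_mult smooth_on_const pu u open_UNIV)
  have 2: "pd i (\<lambda>x. pd i u x + \<theta> $ i * u x) x = pd i (pd i u) x + \<theta> $ i * pd i u x" for i
    by (subst pd_eqI[OF has_derivative_add[OF smooth_on_has_derivative[OF pu UNIV_I]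
            has_derivative_mult_right[OF smooth_on_has_derivative[OF u UNIV_I]]]])
      (simp add: pd_def)
  show ?thesis
    unfolding lap_def pd_exp_mult[OF u] pd_exp_mult[OF s] 2 inner_vec_def[of \<theta> \<theta>]
    by (simp add: algebra_simps sum.distrib sum_distrib_left)
qed

lemma test_function_complex_of_real:
  assumes "open S" "u \<in> test_functions S"
  shows "(\<lambda>x. complex_of_real (u x)) \<in> test_functions S"
  by (rule test_function_bounded_linear[OF assms(1) bounded_linear_of_real assms(2)])

lemma partial_deriv_eq_frechet:
  assumes "f differentiable (at x)"
  shows "partial_deriv i f x = frechet_derivative f (at x) (axis i 1)"
proof -
  have d: "(f has_derivative frechet_derivative f (at x)) (at (x + 0 *\<^sub>R axis i 1))"
    using assms by (simp add: frechet_derivative_works)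
  have "((\<lambda>t. f (x + t *\<^sub>R axis i 1)) has_derivative (\<lambda>r. frechet_derivative f (at x) (r *\<^sub>R axis i 1))) (at 0)"
    by (rule has_derivative_compose[where f="\<lambda>t. x + t *\<^sub>R axis i 1", OF _ d]) (auto intro!: derivative_eq_intros)
  then have "((\<lambda>t. f (x + t *\<^sub>R axis i 1)) has_vector_derivative frechet_derivative f (at x) (axis i 1)) (at 0)"
    using linear_cmul[OF has_derivative_linear[OF d]] by (simp add: has_vector_derivative_def)
  then show ?thesis unfolding partial_deriv_def by (rule vector_derivative_at)
qed

lemma
  assumes f: "f \<in> test_functions (- {0::real^'n::finite})"
  shows partial_deriv_test_function: "partial_deriv i f \<in> test_functions (- {0})"
    and Re_partial_deriv: "Re (partial_deriv i f x) = pd i (\<lambda>x. Re (f x)) x"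
    and Im_partial_deriv: "Im (partial_deriv i f x) = pd i (\<lambda>x. Im (f x)) x"
proof -
  note d = test_function_has_derivative[OF open_punctured f]
  have eq: "partial_deriv i f = (\<lambda>x. frechet_derivative f (at x) (axis i 1))" for i
    by (intro ext partial_deriv_eq_frechet) (use d in \<open>auto simp: differentiable_def\<close>)
  show "partial_deriv i f \<in> test_functions (- {0})"
    unfolding eq by (rule test_function_deriv[OF open_punctured f])
  show "Re (partial_deriv i f x) = pd i (\<lambda>x. Re (f x)) x" "Im (partial_deriv i f x) = pd i (\<lambda>x. Im (f x)) x"
    unfolding eq
    using pd_eqI[OF bounded_linear.has_derivative[OF bounded_linear_Re d]]
      pd_eqI[OF bounded_linear.has_derivative[OF bounded_linear_Im d]] by simp_all
qed

lemma
  assumes f: "f \<in> test_functions (- {0::real^'n::finite})"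
  shows Re_drift_laplacian: "Re (drift_laplacian \<gamma> a f x) =
      lap (\<lambda>x. Re (f x)) x + \<gamma> * (\<Sum>i\<in>UNIV. a $ i * pd i (\<lambda>x. Re (f x)) x)"
    and Im_drift_laplacian: "Im (drift_laplacian \<gamma> a f x) =
      lap (\<lambda>x. Im (f x)) x + \<gamma> * (\<Sum>i\<in>UNIV. a $ i * pd i (\<lambda>x. Im (f x)) x)"
  unfolding drift_laplacian_def laplacian_def lap_def
  using partial_deriv_test_function[OF f]
  by (simp_all add: Re_partial_deriv Im_partial_deriv f)

lemma drift_laplacian_measurable:
  assumes f: "f \<in> test_functions (- {0::real^'n::finite})"
  shows "drift_laplacian \<gamma> a f \<in> borel_measurable borel"
proof -
  have m: "g \<in> borel_measurable borel" if "g \<in> test_functions (- {0::real^'n})" for g :: "real^'n \<Rightarrow> complex"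
    using integrable_test_function[OF open_punctured that] by simp
  show ?thesis
    unfolding drift_laplacian_def[abs_def] laplacian_def
    by (intro borel_measurable_add borel_measurable_times borel_measurable_sum borel_measurable_const m
        partial_deriv_test_function f)
qed

lemma L2_norm_mu_X:
  fixes h :: "real^'n::finite \<Rightarrow> complex"
  assumes h: "h \<in> borel_measurable borel"
  shows "(L2_norm (mu_X \<gamma> a) h)\<^sup>2 =
    (\<integral>x. (exp ((\<gamma> / 2) *\<^sub>R a \<bullet> x) * Re (h x))\<^sup>2 + (exp ((\<gamma> / 2) *\<^sub>R a \<bullet> x) * Im (h x))\<^sup>2 \<partial>lborel)"
proof -
  have e: "exp (\<gamma> * (\<Sum>i\<in>UNIV. a $ i * x $ i)) = (exp ((\<gamma> / 2) *\<^sub>R a \<bullet> x))\<^sup>2" for x :: "real^'n"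
    by (simp add: inner_vec_def power2_eq_square exp_add[symmetric] sum_distrib_left mult_ac)
  have "(L2_norm (mu_X \<gamma> a) h)\<^sup>2 = (\<integral>x. (norm (h x))\<^sup>2 \<partial>(mu_X \<gamma> a))"
    by (simp add: L2_norm_def integral_nonneg)
  also have "\<dots> = (\<integral>x. (exp ((\<gamma> / 2) *\<^sub>R a \<bullet> x))\<^sup>2 *\<^sub>R (norm (h x))\<^sup>2 \<partial>lborel)"
    unfolding mu_X_def e using h by (intro integral_density) auto
  finally show ?thesis by (simp add: cmod_power2 power_mult_distrib algebra_simps)
qed

text \<open>The operator and the weights have real coefficients, so all norms split into the contributions of the
  real and the imaginary part.  The substitution \<open>g = exp (\<theta> \<bullet> x) f\<close> with \<open>\<theta> = \<gamma> a / 2\<close> absorbs the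
  density \<open>exp (2 \<theta> \<bullet> x)\<close>, and \<open>|\<theta>|\<^sup>2 = \<gamma>\<^sup>2 b\<^sub>X\<^sup>2\<close>.\<close>

lemma weighted_norms_eq_energies:
  fixes a :: "real^'n::finite" and \<gamma> :: real and f :: "real^'n \<Rightarrow> complex"
  assumes f: "f \<in> test_functions (- {0})" and m: "real CARD('n) = 2 * m + 4"
  defines "\<theta> \<equiv> (\<gamma> / 2) *\<^sub>R a"
  defines "gR \<equiv> \<lambda>x. exp (\<theta> \<bullet> x) * Re (f x)" and "gI \<equiv> \<lambda>x. exp (\<theta> \<bullet> x) * Im (f x)"
  shows "gR \<in> test_functions (- {0})" "gI \<in> test_functions (- {0})"
    "(L2_norm (mu_X \<gamma> a) (drift_laplacian \<gamma> a f))\<^sup>2 = operator_energy (\<theta> \<bullet> \<theta>) gR + operator_energy (\<theta> \<bullet> \<theta>) gI"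
    "(real CARD('n))\<^sup>2 * (real CARD('n) - 4)\<^sup>2 / 16
          * (L2_norm (mu_X \<gamma> a) (\<lambda>x. f x / complex_of_real ((norm x)\<^sup>2)))\<^sup>2
       + \<gamma> ^ 4 * b_X a ^ 4 * (L2_norm (mu_X \<gamma> a) f)\<^sup>2
       + \<gamma>\<^sup>2 * (b_X a)\<^sup>2 * ((real CARD('n) - 2)\<^sup>2 / 2)
          * (L2_norm (mu_X \<gamma> a) (\<lambda>x. f x / complex_of_real (norm x)))\<^sup>2
     = hardy_energy m (\<theta> \<bullet> \<theta>) gR + hardy_energy m (\<theta> \<bullet> \<theta>) gI"
proof -
  note o = open_punctured[where 'n='n]
  define c where "c = \<theta> \<bullet> \<theta>"
  have R: "(\<lambda>x. Re (f x)) \<in> test_functions (- {0})" and I: "(\<lambda>x. Im (f x)) \<in> test_functions (- {0})"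
    by (intro test_function_bounded_linear[OF o _ f] bounded_linear_Re bounded_linear_Im)+
  show gR: "gR \<in> test_functions (- {0})" and gI: "gI \<in> test_functions (- {0})"
    unfolding gR_def gI_def using test_function_mult[OF o R smooth_on_exp_inner[OF o, of \<theta>]]
      test_function_mult[OF o I smooth_on_exp_inner[OF o, of \<theta>]] by (simp_all add: mult.commute)
  have fm: "f \<in> borel_measurable borel" using integrable_test_function[OF o f] by simp
  have gm: "2 * (\<Sum>i\<in>UNIV. \<theta> $ i * u i) = \<gamma> * (\<Sum>i\<in>UNIV. a $ i * u i)" for u :: "'n \<Rightarrow> real"
    by (simp add: \<theta>_def sum_distrib_left mult_ac)
  have ops: "exp (\<theta> \<bullet> x) * Re (drift_laplacian \<gamma> a f x) = lap gR x - c * gR x"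
    "exp (\<theta> \<bullet> x) * Im (drift_laplacian \<gamma> a f x) = lap gI x - c * gI x" for x
    unfolding Re_drift_laplacian[OF f] Im_drift_laplacian[OF f] gm[symmetric] c_def gR_def gI_def
    by (intro lap_exp_mult[symmetric] test_function_smooth_UNIV[OF o] R I)+
  show "(L2_norm (mu_X \<gamma> a) (drift_laplacian \<gamma> a f))\<^sup>2 = operator_energy (\<theta> \<bullet> \<theta>) gR + operator_energy (\<theta> \<bullet> \<theta>) gI"
    unfolding L2_norm_mu_X[OF drift_laplacian_measurable[OF f]] \<theta>_def[symmetric] ops operator_energy_def c_def[symmetric]
    by (intro Bochner_Integration.integral_add integrable_energies gR gI)
  have n2: "(L2_norm (mu_X \<gamma> a) (\<lambda>x. f x / complex_of_real ((norm x)\<^sup>2)))\<^sup>2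
      = (\<integral>x. (gR x * inverse (x \<bullet> x))\<^sup>2 \<partial>lborel) + (\<integral>x. (gI x * inverse (x \<bullet> x))\<^sup>2 \<partial>lborel)"
  proof -
    have me: "(\<lambda>x. f x / complex_of_real ((norm x)\<^sup>2)) \<in> borel_measurable borel"
      using fm by measurable
    have c: "Re (f x / complex_of_real ((norm x)\<^sup>2)) = Re (f x) * inverse (x \<bullet> x)"
       "Im (f x / complex_of_real ((norm x)\<^sup>2)) = Im (f x) * inverse (x \<bullet> x)" for x
      unfolding Re_divide_of_real Im_divide_of_real by (simp_all add: divide_inverse power2_norm_eq_inner)
    show ?thesis
      unfolding L2_norm_mu_X[OF me] \<theta>_def[symmetric] c mult.assoc[symmetric]
      unfolding gR_def[symmetric] gI_def[symmetric]
      by (subst Bochner_Integration.integral_add[symmetric])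
        (use integrable_energies(1)[OF gR] integrable_energies(1)[OF gI] in \<open>simp_all add: gR_def gI_def\<close>)
  qed
  have n1: "(L2_norm (mu_X \<gamma> a) (\<lambda>x. f x / complex_of_real (norm x)))\<^sup>2
      = (\<integral>x. (gR x)\<^sup>2 * inverse (x \<bullet> x) \<partial>lborel) + (\<integral>x. (gI x)\<^sup>2 * inverse (x \<bullet> x) \<partial>lborel)"
  proof -
    have me: "(\<lambda>x. f x / complex_of_real (norm x)) \<in> borel_measurable borel"
      using fm by measurable
    have c: "(exp (\<theta> \<bullet> x) * Re (f x / complex_of_real (norm x)))\<^sup>2 = (gR x)\<^sup>2 * inverse (x \<bullet> x)"
       "(exp (\<theta> \<bullet> x) * Im (f x / complex_of_real (norm x)))\<^sup>2 = (gI x)\<^sup>2 * inverse (x \<bullet> x)" for x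
      unfolding Re_divide_of_real Im_divide_of_real gR_def gI_def power2_norm_eq_inner[symmetric]
      by (simp_all add: power_mult_distrib power_inverse divide_inverse)
    show ?thesis
      unfolding L2_norm_mu_X[OF me] \<theta>_def[symmetric] c
      by (intro Bochner_Integration.integral_add integrable_energies gR gI)
  qed
  have n0: "(L2_norm (mu_X \<gamma> a) f)\<^sup>2 = (\<integral>x. (gR x)\<^sup>2 \<partial>lborel) + (\<integral>x. (gI x)\<^sup>2 \<partial>lborel)"
    unfolding L2_norm_mu_X[OF fm] \<theta>_def[symmetric] gR_def[symmetric] gI_def[symmetric]
    by (subst Bochner_Integration.integral_add[symmetric])
        (use integrable_energies(2)[OF gR] integrable_energies(2)[OF gI] in \<open>simp_all add: gR_def gI_def\<close>)
  have "\<gamma>\<^sup>2 * (b_X a)\<^sup>2 = c"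
  proof -
    have "(b_X a)\<^sup>2 = 1/4 * (a \<bullet> a)"
      unfolding b_X_def power_mult_distrib by (simp add: sum_nonneg inner_vec_def power2_eq_square)
    then show ?thesis by (simp add: c_def \<theta>_def power2_eq_square)
  qed
  then have c1: "\<gamma>\<^sup>2 * (b_X a)\<^sup>2 = c" and c2: "\<gamma> ^ 4 * b_X a ^ 4 = c\<^sup>2"
    by (auto simp: power_mult_distrib[symmetric] power_mult[symmetric])
  have m1: "(real CARD('n))\<^sup>2 * (real CARD('n) - 4)\<^sup>2 / 16 = (m * (m + 2))\<^sup>2"
    and m2: "(real CARD('n) - 2)\<^sup>2 / 2 = 2 * (m + 1)\<^sup>2"
    unfolding m by (simp_all add: power2_eq_square algebra_simps)
  show "(real CARD('n))\<^sup>2 * (real CARD('n) - 4)\<^sup>2 / 16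
          * (L2_norm (mu_X \<gamma> a) (\<lambda>x. f x / complex_of_real ((norm x)\<^sup>2)))\<^sup>2
       + \<gamma> ^ 4 * b_X a ^ 4 * (L2_norm (mu_X \<gamma> a) f)\<^sup>2
       + \<gamma>\<^sup>2 * (b_X a)\<^sup>2 * ((real CARD('n) - 2)\<^sup>2 / 2)
          * (L2_norm (mu_X \<gamma> a) (\<lambda>x. f x / complex_of_real (norm x)))\<^sup>2
     = hardy_energy m (\<theta> \<bullet> \<theta>) gR + hardy_energy m (\<theta> \<bullet> \<theta>) gI"
    unfolding m1 m2 c1 c2 n0 n1 n2 hardy_energy_def c_def[symmetric]
    by (simp add: algebra_simps)
qed

section \<open>Functions of the logarithm of the radius\<close>

text \<open>The logarithm of the radius is the right variable because the radial Laplacian has constant coefficients in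
  it, up to the factor \<open>|x|\<^sup>-\<^sup>2\<close>; this is why cut-offs that vary slowly in \<open>ln |x|\<close> cost little.\<close>

lemma lap_radial:
  fixes x :: "real^'n::finite" and \<phi> \<phi>1 \<phi>2 :: "real \<Rightarrow> real"
  assumes x: "x \<noteq> 0"
    and d1: "\<And>t. (\<phi> has_real_derivative \<phi>1 t) (at t)"
    and d2: "\<And>t. (\<phi>1 has_real_derivative \<phi>2 t) (at t)"
  shows "lap (\<lambda>x. \<phi> (ln (norm x))) x
    = inverse (x \<bullet> x) * (\<phi>2 (ln (norm x)) + (real CARD('n) - 2) * \<phi>1 (ln (norm x)))"
proof -
  define q where "q = (\<lambda>x::real^'n. inverse (x \<bullet> x))"
  define L where "L = (\<lambda>x::real^'n. ln (norm x))"
  have dL: "(L has_derivative (\<lambda>v. (y \<bullet> v) * q y)) (at y)" if "y \<noteq> 0" for y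
    unfolding L_def q_def by (rule ln_norm_has_derivative[OF that])
  have dq: "(q has_derivative (\<lambda>v. - 2 * (x \<bullet> v) * (q x * q x))) (at x)"
    unfolding q_def by (rule inverse_inner_has_derivative[OF x])
  have comp: "((\<lambda>y. \<psi> (L y)) has_derivative (\<lambda>v. \<psi>' * ((y \<bullet> v) * q y))) (at y)"
    if "(\<psi> has_real_derivative \<psi>') (at (L y))" "y \<noteq> 0" for \<psi> \<psi>' y
    using has_derivative_compose[OF dL[OF that(2)], of \<psi> "(*) \<psi>'"] that(1)
    by (simp add: has_field_derivative_def)
  have p1: "pd i (\<lambda>y. \<phi> (L y)) y = \<phi>1 (L y) * (y $ i * q y)" if "y \<noteq> 0" for i y
    using pd_eqI[OF comp[OF d1 that]] by (simp add: inner_axis)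
  have "pd i (pd i (\<lambda>y. \<phi> (L y))) x = (\<phi>2 (L x) * (q x)\<^sup>2 - 2 * \<phi>1 (L x) * (q x)\<^sup>2) * (x $ i)\<^sup>2
      + \<phi>1 (L x) * q x" for i
  proof -
    have D: "((\<lambda>y. \<phi>1 (L y) * (y $ i * q y)) has_derivative
      (\<lambda>v. \<phi>1 (L x) * (x $ i * (- 2 * (x \<bullet> v) * (q x * q x)) + v $ i * q x)
         + (\<phi>2 (L x) * ((x \<bullet> v) * q x)) * (x $ i * q x))) (at x)"
      by (intro has_derivative_mult comp[OF d2 x] dq bounded_linear.has_derivative[OF bounded_linear_vec_nth has_derivative_ident])
    have "(pd i (\<lambda>y. \<phi> (L y)) has_derivative
      (\<lambda>v. \<phi>1 (L x) * (x $ i * (- 2 * (x \<bullet> v) * (q x * q x)) + v $ i * q x)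
         + (\<phi>2 (L x) * ((x \<bullet> v) * q x)) * (x $ i * q x))) (at x)"
      by (rule has_derivative_transform_within_open[OF D open_punctured]) (use x p1 in auto)
    from pd_eqI[OF this] show ?thesis
      by (simp add: inner_axis algebra_simps power2_eq_square)
  qed
  then have "lap (\<lambda>y. \<phi> (L y)) x = (\<phi>2 (L x) * (q x)\<^sup>2 - 2 * \<phi>1 (L x) * (q x)\<^sup>2) * (x \<bullet> x)
      + real CARD('n) * (\<phi>1 (L x) * q x)"
    by (simp add: lap_def sum.distrib sum_distrib_left[symmetric] inner_vec_def power2_eq_square)
  moreover have "(q x)\<^sup>2 * (x \<bullet> x) = q x" using x by (simp add: q_def power2_eq_square)
  ultimately have "lap (\<lambda>y. \<phi> (L y)) x = q x * (\<phi>2 (L x) + (real CARD('n) - 2) * \<phi>1 (L x))"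
    by algebra
  then show ?thesis by (simp add: L_def q_def)
qed

text \<open>The parameters are the logarithms of the radii.\<close>

definition annulus :: "real \<Rightarrow> real \<Rightarrow> 'a::euclidean_space set" where
  "annulus \<alpha> \<beta> = {x. exp \<alpha> \<le> norm x \<and> norm x \<le> exp \<beta>}"

lemma annulus_ln: "x \<noteq> 0 \<Longrightarrow> x \<in> annulus \<alpha> \<beta> \<longleftrightarrow> \<alpha> \<le> ln (norm x) \<and> ln (norm x) \<le> \<beta>"
  using ln_le_cancel_iff[of "norm x" "exp \<beta>"] by (simp add: annulus_def ln_ge_iff)

lemma zero_notin_annulus: "0 \<notin> annulus \<alpha> \<beta>"
  by (simp add: annulus_def not_le)

lemma compact_annulus: "compact (annulus \<alpha> \<beta> :: 'a::euclidean_space set)"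
proof -
  have "(annulus \<alpha> \<beta> :: 'a set) = cball 0 (exp \<beta>) - ball 0 (exp \<alpha>)"
    by (auto simp: annulus_def)
  then show ?thesis by (simp add: compact_diff)
qed

text \<open>This is \<open>|x|\<^sup>-\<^sup>n\<close>, the density of a dilation invariant measure, written in the variable \<open>ln |x|\<close>.\<close>

definition hardy_weight :: "'a::euclidean_space \<Rightarrow> real" where
  "hardy_weight x = exp (- real DIM('a) * ln (norm x))"

definition annulus_mass :: "'a::euclidean_space itself \<Rightarrow> real \<Rightarrow> real \<Rightarrow> real" where
  "annulus_mass _ \<alpha> \<beta> = (\<integral>x. indicator (annulus \<alpha> \<beta>) x * hardy_weight (x::'a) \<partial>lborel)"

lemma integrable_annulus: "integrable lborel (\<lambda>x::'a::euclidean_space. indicator (annulus \<alpha> \<beta>) x * hardy_weight x)"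
proof -
  have "continuous_on (annulus \<alpha> \<beta>) (hardy_weight :: 'a \<Rightarrow> real)"
    unfolding hardy_weight_def[abs_def] using zero_notin_annulus by (intro continuous_intros) auto
  from borel_integrable_compact[OF compact_annulus this] show ?thesis by simp
qed

text \<open>In the variable \<open>ln |x|\<close> the measure \<open>|x|\<^sup>-\<^sup>n dx\<close> is translation invariant, because dilations of the space
  become translations.  This replaces integration in polar coordinates.\<close>

lemma annulus_mass_translate: "annulus_mass TYPE('a::euclidean_space) (s + \<alpha>) (s + \<beta>) = annulus_mass TYPE('a) \<alpha> \<beta>"
proof -
  define g where "g = (\<lambda>x::'a. indicat_real (annulus (s + \<alpha>) (s + \<beta>)) x * hardy_weight x)"
  have gm: "g \<in> borel_measurable borel" using borel_measurable_integrable[OF integrable_annulus[of "s + \<alpha>" "s + \<beta>"]] by (simp add: g_def)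
  have pt: "exp s ^ DIM('a) * g (exp s *\<^sub>R x) = indicator (annulus \<alpha> \<beta>) x * hardy_weight x" for x
  proof (cases "x = 0")
    case True
    then show ?thesis by (simp add: g_def zero_notin_annulus)
  next
    case False
    have "exp s ^ DIM('a) * hardy_weight (exp s *\<^sub>R x) = hardy_weight x"
      using False by (simp add: hardy_weight_def ln_mult exp_of_nat_mult[symmetric] exp_add[symmetric] algebra_simps)
    moreover have "exp s *\<^sub>R x \<in> annulus (s + \<alpha>) (s + \<beta>) \<longleftrightarrow> x \<in> annulus \<alpha> \<beta>"
      by (simp add: annulus_def exp_add)
    ultimately show ?thesis by (simp add: g_def indicator_def)
  qed
  have "(\<integral>x. g x \<partial>lborel) = (\<integral>x. g x \<partial>density (distr lborel borel (\<lambda>x. 0 + exp s *\<^sub>R x)) (\<lambda>_. ennreal (exp s ^ DIM('a))))"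
    using lborel_affine[of "exp s" "0::'a"] by (simp add: ennreal_power)
  also have "\<dots> = (\<integral>x. exp s ^ DIM('a) *\<^sub>R g x \<partial>distr lborel borel (\<lambda>x. 0 + exp s *\<^sub>R x))"
    using gm by (intro integral_density) auto
  also have "\<dots> = (\<integral>x. exp s ^ DIM('a) *\<^sub>R g (0 + exp s *\<^sub>R x) \<partial>lborel)"
    using gm by (intro integral_distr) auto
  finally show ?thesis by (simp add: pt annulus_mass_def) (simp add: g_def)
qed

lemma annulus_mass_split:
  "annulus_mass TYPE('a::euclidean_space) \<alpha> \<gamma> \<le> annulus_mass TYPE('a) \<alpha> \<beta> + annulus_mass TYPE('a) \<beta> \<gamma>"
proof -
  have "annulus_mass TYPE('a) \<alpha> \<gamma> \<le> (\<integral>x. indicator (annulus \<alpha> \<beta>) x * hardy_weight (x::'a)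
      + indicator (annulus \<beta> \<gamma>) x * hardy_weight x \<partial>lborel)"
    unfolding annulus_mass_def
    by (intro integral_mono Bochner_Integration.integrable_add integrable_annulus)
      (auto simp: indicator_def annulus_def hardy_weight_def)
  also have "\<dots> = annulus_mass TYPE('a) \<alpha> \<beta> + annulus_mass TYPE('a) \<beta> \<gamma>"
    unfolding annulus_mass_def by (intro Bochner_Integration.integral_add integrable_annulus)
  finally show ?thesis .
qed

section \<open>Almost extremal functions\<close>

text \<open>The power \<open>|x|\<^sup>-\<^sup>m\<close> is the formal extremal of Rellich's inequality; it is cut off smoothly on the scale
  \<open>N\<close> in the variable \<open>ln |x|\<close>.  The cut-off is centred at \<open>- 2 N\<close>, not at \<open>0\<close>, so that the functions
  concentrate at the origin, where the terms with \<open>|x|\<^sup>-\<^sup>2\<close> and without a singular weight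
  become negligible.\<close>

definition optimizer :: "real \<Rightarrow> real \<Rightarrow> real^'n::finite \<Rightarrow> real" where
  "optimizer m N x = exp (- m * ln (norm x)) * bump (ln (norm x) / N + 2)"

lemma abs_log_window_le_iff: "N > 0 \<Longrightarrow> \<bar>l / N + 2\<bar> \<le> r \<longleftrightarrow> - (2 + r) * N \<le> l \<and> l \<le> (r - 2) * (N::real)"
  by (auto simp: abs_le_iff field_simps)

lemma optimizer_eq_0:
  assumes "N > 0" "x \<notin> annulus (- 3 * N) (- N)"
  shows "optimizer m N x = 0"
proof (cases "x = 0")
  case False
  then have "\<not> \<bar>ln (norm x) / N + 2\<bar> \<le> 1"
    using assms by (simp add: annulus_ln abs_log_window_le_iff)
  then show ?thesis by (simp add: optimizer_def bump_eq_0)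
qed (simp add: optimizer_def bump_eq_0)

lemma optimizer_test_function:
  assumes "N > 0"
  shows "(optimizer m N :: real^'n::finite \<Rightarrow> real) \<in> test_functions (- {0})"
proof (rule test_functionsI[OF _ compact_annulus])
  note o = open_punctured[where 'n='n]
  have l: "smooth_on (- {0}) (\<lambda>x::real^'n. ln (norm x))" by (rule smooth_on_ln_norm[OF o]) simp
  have "smooth_on (- {0}) (\<lambda>x::real^'n. exp ((- m) * ln (norm x)))"
    by (intro smooth_on_compose_real[OF o smooth_on_exp] smooth_on_mult smooth_on_const l o)
  moreover have "smooth_on (- {0}) (\<lambda>x::real^'n. bump (inverse N * ln (norm x) + 2))"
    by (intro smooth_on_compose_real[OF o smooth_on_bump] smooth_on_add smooth_on_mult smooth_on_const l o)
  ultimately have "smooth_on (- {0}) (\<lambda>x::real^'n. exp ((- m) * ln (norm x)) * bump (inverse N * ln (norm x) + 2))"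
    by (rule smooth_on_mult[OF o])
  then show "smooth_on (- {0}) (optimizer m N :: real^'n \<Rightarrow> real)"
    by (simp add: optimizer_def[abs_def] divide_inverse mult.commute)
  show "optimizer m N x = 0" if "x \<notin> annulus (- 3 * N) (- N)" for x :: "real^'n"
    by (rule optimizer_eq_0[OF assms that])
  show "annulus (- 3 * N) (- N) \<subseteq> - {0::real^'n}" using zero_notin_annulus by auto
qed

lemma hardy_weight_eq:
  fixes x :: "real^'n::finite"
  assumes "x \<noteq> 0" and m: "real CARD('n) = 2 * m + 4"
  shows "(inverse (x \<bullet> x) * exp (- m * ln (norm x)))\<^sup>2 = hardy_weight x"
proof -
  have "x \<bullet> x = exp (2 * ln (norm x))"
    using assms(1) by (simp add: exp_double power2_norm_eq_inner)
  then show ?thesis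
    using m by (simp add: hardy_weight_def exp_minus[symmetric] exp_add[symmetric] power2_eq_square algebra_simps)
qed

lemma optimizer_hardy_density:
  fixes x :: "real^'n::finite"
  assumes "x \<noteq> 0" and "real CARD('n) = 2 * m + 4"
  shows "(optimizer m N x * inverse (x \<bullet> x))\<^sup>2 = hardy_weight x * (bump (ln (norm x) / N + 2))\<^sup>2"
  unfolding hardy_weight_eq[OF assms, symmetric] optimizer_def by (simp add: power_mult_distrib mult_ac)

text \<open>The support of the cut-off consists of two logarithmic intervals of length \<open>N\<close>, and so does not have more than
  twice the mass of the interval of length \<open>N\<close> around its centre, on which the bump is at least
  \<open>exp (- 2)\<close>.\<close>

lemma annulus_mass_le_energy:
  assumes N: "N > 0" and m: "real CARD('n::finite) = 2 * m + 4"
  shows "annulus_mass TYPE(real^'n) (- 3 * N) (- N)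
    \<le> 2 * exp 4 * (\<integral>x. (optimizer m N (x::real^'n) * inverse (x \<bullet> x))\<^sup>2 \<partial>lborel)"
proof -
  let ?J = "\<lambda>x::real^'n. (optimizer m N x * inverse (x \<bullet> x))\<^sup>2"
  have "annulus_mass TYPE(real^'n) (- 3 * N) (- N)
      \<le> annulus_mass TYPE(real^'n) (- 3 * N) (- 2 * N) + annulus_mass TYPE(real^'n) (- 2 * N) (- N)"
    by (rule annulus_mass_split)
  also have "\<dots> = 2 * annulus_mass TYPE(real^'n) (- 5 / 2 * N) (- 3 / 2 * N)"
    using annulus_mass_translate[where 'a="real^'n", of "- N / 2" "- 5 / 2 * N" "- 3 / 2 * N"]
      annulus_mass_translate[where 'a="real^'n", of "N / 2" "- 5 / 2 * N" "- 3 / 2 * N"] by simp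
  also have "annulus_mass TYPE(real^'n) (- 5 / 2 * N) (- 3 / 2 * N) \<le> (\<integral>x. exp 4 * ?J x \<partial>lborel)"
    unfolding annulus_mass_def
  proof (rule integral_mono)
    show "integrable lborel (\<lambda>x. exp 4 * ?J x)"
      by (intro integrable_mult_right integrable_energies(1) optimizer_test_function N)
    show "indicator (annulus (- 5 / 2 * N) (- 3 / 2 * N)) x * hardy_weight x \<le> exp 4 * ?J x" for x
    proof (cases "x \<in> annulus (- 5 / 2 * N) (- 3 / 2 * N)")
      case True
      then have x: "x \<noteq> 0" using zero_notin_annulus by metis
      have "\<bar>ln (norm x) / N + 2\<bar> \<le> 1 / 2"
        using True unfolding abs_log_window_le_iff[OF N] annulus_ln[OF x] by (simp add: field_simps)
      then have "(exp (- 2))\<^sup>2 \<le> (bump (ln (norm x) / N + 2))\<^sup>2"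
        by (intro power_mono bump_lower_bound) auto
      then have "1 \<le> exp 4 * (bump (ln (norm x) / N + 2))\<^sup>2"
        by (simp add: exp_double[symmetric] exp_minus field_simps)
      then have "hardy_weight x * 1 \<le> hardy_weight x * (exp 4 * (bump (ln (norm x) / N + 2))\<^sup>2)"
        by (intro mult_left_mono) (auto simp: hardy_weight_def)
      then show ?thesis unfolding optimizer_hardy_density[OF x m] using True by (simp add: mult.left_commute)
    qed simp
  qed (rule integrable_annulus)
  finally show ?thesis by simp
qed

lemma optimizer_nonzero:
  assumes "N > 0" shows "\<exists>x::real^'n::finite. optimizer m N x \<noteq> 0"
proof -
  obtain x :: "real^'n" where x: "norm x = exp (- 2 * N)"
    using vector_choose_size[of "exp (- 2 * N)"] by auto
  have "bump 0 \<noteq> 0" using bump_lower_bound[of 0] exp_gt_zero[of "- 2 :: real"] by linarith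
  then have "optimizer m N x \<noteq> 0" using assms by (simp add: optimizer_def x)
  then show ?thesis by blast
qed

lemma integral_pos_test_function:
  fixes g :: "real^'n::finite \<Rightarrow> real"
  assumes g: "g \<in> test_functions (- {0})" and x0: "g x0 \<noteq> 0"
  shows "0 < (\<integral>x. (g x * inverse (x \<bullet> x))\<^sup>2 \<partial>lborel)"
proof (rule ccontr)
  assume "\<not> ?thesis"
  then have "(\<integral>x. (g x * inverse (x \<bullet> x))\<^sup>2 \<partial>lborel) = 0"
    by (intro antisym integral_nonneg) auto
  then have "AE x in lborel. (g x * inverse (x \<bullet> x))\<^sup>2 = 0"
    using integral_nonneg_eq_0_iff_AE[OF integrable_energies(1)[OF g]] by simp
  moreover have "g 0 = 0"
  proof -
    have "0 \<notin> closure {x. g x \<noteq> 0}" using g by (auto simp: test_functions_def)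
    then show ?thesis using closure_subset[of "{x. g x \<noteq> 0}"] by auto
  qed
  ultimately have "AE x in lborel. \<not> g x \<noteq> 0"
    by (auto elim!: eventually_mono)
  moreover have o: "open {x. g x \<noteq> 0}"
    using smooth_on_imp_continuous[OF test_function_smooth_UNIV[OF open_punctured g]]
    by (intro open_Collect_neq continuous_on_const) auto
  ultimately have "{x. g x \<noteq> 0} \<in> null_sets lborel"
    using AE_iff_null_sets[of "{x. g x \<noteq> 0}" lborel] by simp
  then have "negligible {x. g x \<noteq> 0}"
    using null_sets_completionI negligible_iff_null_sets by blast
  then show False using open_not_negligible[OF o] x0 by blast
qed

text \<open>On \<open>|x|\<^sup>-\<^sup>m u(ln |x|)\<close> the Laplacian acts as \<open>u'' + 2 u' - m (m + 2) u\<close>, up to a power of \<open>|x|\<close>.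
  Every derivative of the cut-off brings a factor \<open>1 / N\<close>.\<close>

lemma optimizer_operator_density:
  fixes x :: "real^'n::finite"
  assumes x: "x \<noteq> 0" and m: "real CARD('n) = 2 * m + 4" and N: "N > 0"
    and b1: "\<And>t. (bump has_real_derivative b1 t) (at t)" and b2: "\<And>t. (b1 has_real_derivative b2 t) (at t)"
  defines "\<tau> \<equiv> ln (norm x) / N + 2"
  shows "(lap (optimizer m N) x - c * optimizer m N x)\<^sup>2
    = hardy_weight x * (- (m * (m + 2) + c * (x \<bullet> x)) * bump \<tau> + (b2 \<tau> / N\<^sup>2 + 2 * b1 \<tau> / N))\<^sup>2"
proof -
  let ?e = "\<lambda>t. exp (- m * t)" and ?s = "\<lambda>t. t / N + 2"
  have d0: "((\<lambda>t. h (?s t)) has_real_derivative h' (?s t) / N) (at t)"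
    if "\<And>t. (h has_real_derivative h' t) (at t)" for h h' t
  proof -
    have "(?s has_real_derivative 1 / N) (at t)" using N by (auto intro!: derivative_eq_intros)
    from DERIV_chain2[OF that this] show ?thesis by simp
  qed
  define \<phi> where "\<phi> = (\<lambda>t. ?e t * bump (?s t))"
  define \<phi>1 where "\<phi>1 = (\<lambda>t. ?e t * (b1 (?s t) / N - m * bump (?s t)))"
  define \<phi>2 where "\<phi>2 = (\<lambda>t. ?e t * (b2 (?s t) / N\<^sup>2 - 2 * m * b1 (?s t) / N + m\<^sup>2 * bump (?s t)))"
  have de: "(?e has_real_derivative - m * ?e t) (at t)" for t
    by (auto intro!: derivative_eq_intros)
  have d1: "(\<phi> has_real_derivative \<phi>1 t) (at t)" for t
    unfolding \<phi>_def \<phi>1_def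
    by (rule DERIV_cong[OF DERIV_mult[OF de d0[OF b1]]]) (simp add: algebra_simps)
  have d2: "(\<phi>1 has_real_derivative \<phi>2 t) (at t)" for t
    unfolding \<phi>1_def \<phi>2_def
    by (rule DERIV_cong[OF DERIV_mult[OF de DERIV_diff[OF DERIV_cdivide[OF d0[OF b2]] DERIV_cmult[OF d0[OF b1]]]]])
      (simp add: algebra_simps power2_eq_square)
  have "optimizer m N = (\<lambda>x::real^'n. \<phi> (ln (norm x)))" by (simp add: optimizer_def[abs_def] \<phi>_def)
  then have "lap (optimizer m N) x - c * optimizer m N x
     = inverse (x \<bullet> x) * (\<phi>2 (ln (norm x)) + (2 * m + 2) * \<phi>1 (ln (norm x))) - c * \<phi> (ln (norm x))"
    by (simp add: lap_radial[OF x d1 d2] m)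
  also have "\<dots> = (inverse (x \<bullet> x) * ?e (ln (norm x)))
      * (- (m * (m + 2) + c * (x \<bullet> x)) * bump \<tau> + (b2 \<tau> / N\<^sup>2 + 2 * b1 \<tau> / N))"
  proof -
    have "inverse (x \<bullet> x) * (x \<bullet> x) = 1" using x by simp
    then show ?thesis unfolding \<phi>_def \<phi>1_def \<phi>2_def \<tau>_def divide_inverse by algebra
  qed
  finally show ?thesis by (simp add: power_mult_distrib hardy_weight_eq[OF x m, symmetric])
qed

lemma square_sum_weighted_bound:
  fixes A B h :: real
  assumes "h > 0"
  shows "(A + B)\<^sup>2 \<le> (1 + 1 / h) * A\<^sup>2 + (1 + h) * B\<^sup>2"
proof -
  have "(1 + 1 / h) * A\<^sup>2 + (1 + h) * B\<^sup>2 - (A + B)\<^sup>2 = (A - h * B)\<^sup>2 / h"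
    using assms by (simp add: field_simps power2_eq_square)
  moreover have "\<dots> \<ge> 0" using assms by simp
  ultimately show ?thesis by linarith
qed

text \<open>The main part of the operator energy comes from \<open>m (m + 2) u\<close>.  The term with \<open>c\<close> carries
  \<open>|x|\<^sup>2 \<le> exp (- 2 N) \<le> 1 / N\<close>.  The square of the terms with derivatives of the cut-off is
  \<open>O(1 / N\<^sup>2)\<close> times the weight of the supporting annulus; this leaves room for the factor \<open>1 + N\<close>, the
  price of having only \<open>1 + 1 / N\<close> in front of the main part.\<close>

lemma optimizer_energy_bound:
  fixes c m :: real
  assumes m: "real CARD('n::finite) = 2 * m + 4" "m \<ge> 0" and c: "c \<ge> 0"
  obtains C where "\<And>N. N \<ge> 1 \<Longrightarrow> operator_energy c (optimizer m N :: real^'n \<Rightarrow> real)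
    \<le> ((1 + 1 / N) * (m * (m + 2) + c * (1 / N))\<^sup>2 + C * (1 / N + (1 / N)\<^sup>2))
        * (\<integral>x. (optimizer m N (x::real^'n) * inverse (x \<bullet> x))\<^sup>2 \<partial>lborel)"
proof -
  obtain b1 b2 M where b1: "\<And>t. (bump has_real_derivative b1 t) (at t)"
    and b2: "\<And>t. (b1 has_real_derivative b2 t) (at t)"
    and M: "\<And>t. \<bar>b1 t\<bar> \<le> M" "\<And>t. \<bar>b2 t\<bar> \<le> M"
    and z: "\<And>t. \<bar>t\<bar> > 1 \<Longrightarrow> b1 t = 0" "\<And>t. \<bar>t\<bar> > 1 \<Longrightarrow> b2 t = 0"
    using bump_derivatives by blast
  have M0: "M \<ge> 0" using M(1)[of 0] by linarith
  define K where "K = m * (m + 2)"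
  have K: "K \<ge> 0" using m by (simp add: K_def)
  have "operator_energy c (optimizer m N :: real^'n \<Rightarrow> real)
    \<le> ((1 + 1 / N) * (K + c * (1 / N))\<^sup>2 + 18 * M\<^sup>2 * exp 4 * (1 / N + (1 / N)\<^sup>2))
        * (\<integral>x. (optimizer m N (x::real^'n) * inverse (x \<bullet> x))\<^sup>2 \<partial>lborel)" if N1: "N \<ge> 1" for N
  proof -
    have N: "N > 0" using N1 by simp
    note T = optimizer_test_function[OF N, where 'n='n and m=m]
    let ?J = "\<lambda>x::real^'n. (optimizer m N x * inverse (x \<bullet> x))\<^sup>2"
    let ?I = "\<lambda>x::real^'n. indicator (annulus (- 3 * N) (- N)) x * hardy_weight x"
    have pt: "(lap (optimizer m N) x - c * optimizer m N x)\<^sup>2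
        \<le> (1 + 1 / N) * (K + c * (1 / N))\<^sup>2 * ?J x + (1 + N) * (3 * M / N)\<^sup>2 * ?I x"
      if x: "x \<noteq> 0" for x :: "real^'n"
    proof -
      define \<tau> where "\<tau> = ln (norm x) / N + 2"
      have w0: "hardy_weight x \<ge> 0" by (simp add: hardy_weight_def)
      define A where "A = - (K + c * (x \<bullet> x)) * bump \<tau>"
      define B where "B = b2 \<tau> / N\<^sup>2 + 2 * b1 \<tau> / N"
      have ind: "x \<in> annulus (- 3 * N) (- N) \<longleftrightarrow> \<bar>\<tau>\<bar> \<le> 1"
        unfolding annulus_ln[OF x] \<tau>_def using abs_log_window_le_iff[OF N, of "ln (norm x)" 1] by simp
      have A: "A\<^sup>2 \<le> (K + c * (1 / N))\<^sup>2 * (bump \<tau>)\<^sup>2"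
      proof (cases "\<bar>\<tau>\<bar> \<le> 1")
        case True
        then have "norm x \<le> exp (- N)" using ind by (simp add: annulus_def)
        then have "(norm x)\<^sup>2 \<le> exp (- N) * 1"
          unfolding power2_eq_square using N by (intro mult_mono) (auto elim: order_trans)
        also have "\<dots> = 1 / exp N" by (simp add: exp_minus divide_inverse)
        also have "1 / exp N \<le> 1 / N"
        proof (rule divide_left_mono)
          show "N \<le> exp N" using exp_ge_add_one_self[of N] by linarith
        qed (use N in auto)
        finally have "x \<bullet> x \<le> 1 / N" by (simp add: power2_norm_eq_inner)
        then have "(K + c * (x \<bullet> x))\<^sup>2 \<le> (K + c * (1 / N))\<^sup>2"
          using K c by (intro power_mono add_left_mono mult_left_mono) auto
        then show ?thesis unfolding A_def power_mult_distrib power2_minus by (rule mult_right_mono) simp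
      qed (simp add: A_def bump_eq_0)
      have B: "B\<^sup>2 \<le> (3 * M / N)\<^sup>2 * indicator (annulus (- 3 * N) (- N)) x"
      proof (cases "\<bar>\<tau>\<bar> \<le> 1")
        case True
        have "\<bar>b2 \<tau> / N\<^sup>2\<bar> \<le> M / N"
        proof -
          have "N * 1 \<le> N * N" using N1 by (intro mult_left_mono) auto
          then show ?thesis unfolding abs_divide using M(2)[of \<tau>] N M0
            by (intro frac_le) (auto simp: power2_eq_square)
        qed
        moreover have "\<bar>2 * b1 \<tau> / N\<bar> \<le> 2 * M / N"
          unfolding abs_divide using M(1)[of \<tau>] N by (intro frac_le) auto
        ultimately have "\<bar>B\<bar> \<le> 3 * M / N"
          using abs_triangle_ineq[of "b2 \<tau> / N\<^sup>2" "2 * b1 \<tau> / N"]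
            add_divide_distrib[of M "2 * M" N] unfolding B_def by simp
        then show ?thesis using True ind power_mono[of "\<bar>B\<bar>" "3 * M / N" 2] by simp
      qed (use z in \<open>simp add: B_def\<close>)
      have "(lap (optimizer m N) x - c * optimizer m N x)\<^sup>2 = hardy_weight x * (A + B)\<^sup>2"
        unfolding A_def B_def K_def \<tau>_def by (rule optimizer_operator_density[OF x m(1) N b1 b2])
      also have "\<dots> \<le> hardy_weight x * ((1 + 1 / N) * ((K + c * (1 / N))\<^sup>2 * (bump \<tau>)\<^sup>2)
          + (1 + N) * ((3 * M / N)\<^sup>2 * indicator (annulus (- 3 * N) (- N)) x))"
        using A B N
        by (intro mult_left_mono[OF _ w0] order_trans[OF square_sum_weighted_bound[OF N]] add_mono mult_left_mono) auto
      also have "\<dots> = (1 + 1 / N) * (K + c * (1 / N))\<^sup>2 * ?J x + (1 + N) * (3 * M / N)\<^sup>2 * ?I x"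
        unfolding optimizer_hardy_density[OF x m(1)] \<tau>_def by (simp only: algebra_simps)
      finally show ?thesis .
    qed
    have "operator_energy c (optimizer m N :: real^'n \<Rightarrow> real)
      \<le> (\<integral>x. (1 + 1 / N) * (K + c * (1 / N))\<^sup>2 * ?J x + (1 + N) * (3 * M / N)\<^sup>2 * ?I x \<partial>lborel)"
      unfolding operator_energy_def
    proof (rule integral_mono_AE)
      show "AE x in lborel. (lap (optimizer m N) x - c * optimizer m N x)\<^sup>2
        \<le> (1 + 1 / N) * (K + c * (1 / N))\<^sup>2 * ?J x + (1 + N) * (3 * M / N)\<^sup>2 * ?I x"
        using AE_lborel_singleton[of "0::real^'n"] pt by (auto elim: eventually_mono)
    qed (intro Bochner_Integration.integrable_add integrable_mult_right integrable_annulus integrable_energies T)+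
    also have "\<dots> = (1 + 1 / N) * (K + c * (1 / N))\<^sup>2 * (\<integral>x. ?J x \<partial>lborel)
       + (1 + N) * (3 * M / N)\<^sup>2 * annulus_mass TYPE(real^'n) (- 3 * N) (- N)"
      unfolding annulus_mass_def
      by (subst Bochner_Integration.integral_add)
        (intro integrable_mult_right integrable_annulus integrable_energies T | simp)+
    also have "\<dots> \<le> (1 + 1 / N) * (K + c * (1 / N))\<^sup>2 * (\<integral>x. ?J x \<partial>lborel)
       + (1 + N) * (3 * M / N)\<^sup>2 * (2 * exp 4 * (\<integral>x. ?J x \<partial>lborel))"
      using annulus_mass_le_energy[OF N m(1)] N by (intro add_left_mono mult_left_mono) auto
    also have "\<dots> = ((1 + 1 / N) * (K + c * (1 / N))\<^sup>2 + 18 * M\<^sup>2 * exp 4 * (1 / N + (1 / N)\<^sup>2)) * (\<integral>x. ?J x \<partial>lborel)"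
    proof -
      have "(1 + N) * (3 * M / N)\<^sup>2 = 9 * M\<^sup>2 * (1 / N + (1 / N)\<^sup>2)"
        using N by (simp add: field_simps power2_eq_square)
      then show ?thesis by algebra
    qed
    finally show ?thesis .
  qed
  then show ?thesis using that unfolding K_def by blast
qed

text \<open>The quotient is at least \<open>1\<close> by the inequality itself, so an upper bound suffices; for this only
  the Rellich term of the denominator is kept.  Division by it requires \<open>m > 0\<close>, that is \<open>n \<ge> 5\<close>.\<close>

lemma optimizer_quotient_limit:
  fixes c m :: real
  assumes m: "real CARD('n::finite) = 2 * m + 4" "m > 0" and c: "c \<ge> 0"
  defines "G \<equiv> \<lambda>k. optimizer m (real (Suc k)) :: real^'n \<Rightarrow> real"
  shows "(\<lambda>k. operator_energy c (G k) / hardy_energy m c (G k)) \<longlonglongrightarrow> 1"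
proof -
  define K where "K = m * (m + 2)"
  have K: "K > 0" using m by (simp add: K_def)
  have m0: "m \<ge> 0" using m by simp
  obtain C where C: "\<And>N. N \<ge> 1 \<Longrightarrow> operator_energy c (optimizer m N :: real^'n \<Rightarrow> real)
    \<le> ((1 + 1 / N) * (K + c * (1 / N))\<^sup>2 + C * (1 / N + (1 / N)\<^sup>2))
        * (\<integral>x. (optimizer m N (x::real^'n) * inverse (x \<bullet> x))\<^sup>2 \<partial>lborel)"
    using optimizer_energy_bound[OF m(1) m0 c] unfolding K_def by blast
  define h where "h k = 1 / real (Suc k)" for k
  define U where "U k = ((1 + h k) * (K + c * h k)\<^sup>2 + C * (h k + (h k)\<^sup>2)) / K\<^sup>2" for k
  have bounds: "1 \<le> operator_energy c (G k) / hardy_energy m c (G k) \<and>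
      operator_energy c (G k) / hardy_energy m c (G k) \<le> U k" for k
  proof -
    have N: "real (Suc k) > 0" by simp
    have T: "G k \<in> test_functions (- {0})" unfolding G_def by (rule optimizer_test_function[OF N])
    define J where "J = (\<integral>x. (G k x * inverse (x \<bullet> x))\<^sup>2 \<partial>lborel)"
    have J: "J > 0"
      using optimizer_nonzero[OF N] integral_pos_test_function[OF T] unfolding J_def G_def by blast
    have HJ: "K\<^sup>2 * J \<le> hardy_energy m c (G k)"
      using c unfolding hardy_energy_def K_def J_def
      by (simp add: add_nonneg_nonneg mult_nonneg_nonneg integral_nonneg)
    have KJ: "K\<^sup>2 * J > 0" using K J by simp
    have H0: "hardy_energy m c (G k) > 0" using HJ KJ by linarith
    have low: "hardy_energy m c (G k) \<le> operator_energy c (G k)"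
      by (rule hardy_rellich_real[OF T m(1) m0 c])
    have up: "operator_energy c (G k) \<le> U k * (K\<^sup>2 * J)"
      using C[of "real (Suc k)"] K unfolding U_def h_def J_def G_def by simp
    have U0: "0 \<le> U k"
      using up low H0 KJ by (smt (verit) zero_less_mult_iff mult_neg_pos)
    have "operator_energy c (G k) \<le> U k * hardy_energy m c (G k)"
      using up mult_left_mono[OF HJ U0] by linarith
    then show ?thesis using low H0 by (simp add: divide_le_eq le_divide_eq)
  qed
  have h: "h \<longlonglongrightarrow> 0"
    using LIMSEQ_inverse_real_of_nat by (simp add: h_def[abs_def] inverse_eq_divide)
  have "U \<longlonglongrightarrow> ((1 + 0) * (K + c * 0)\<^sup>2 + C * (0 + 0\<^sup>2)) / K\<^sup>2"
    unfolding U_def using K by (intro tendsto_intros h) auto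
  then have "U \<longlonglongrightarrow> 1" using K by simp
  then show ?thesis
    by (rule tendsto_sandwich[rotated 2, OF tendsto_const]) (use bounds in auto)
qed

theorem mainTheorem4:
  fixes a :: "real^'n::finite" and \<gamma> :: real
  assumes "CARD('n) \<ge> 5"
  shows "(\<forall>f \<in> test_functions (- {0}).
            (L2_norm (mu_X \<gamma> a) (drift_laplacian \<gamma> a f))\<^sup>2
            \<ge> (real CARD('n))\<^sup>2 * (real CARD('n) - 4)\<^sup>2 / 16
                 * (L2_norm (mu_X \<gamma> a) (\<lambda>x. f x / complex_of_real ((norm x)\<^sup>2)))\<^sup>2
              + \<gamma> ^ 4 * b_X a ^ 4 * (L2_norm (mu_X \<gamma> a) f)\<^sup>2
              + \<gamma>\<^sup>2 * (b_X a)\<^sup>2 * ((real CARD('n) - 2)\<^sup>2 / 2)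
                 * (L2_norm (mu_X \<gamma> a) (\<lambda>x. f x / complex_of_real (norm x)))\<^sup>2)
       \<and> (\<exists>F :: nat \<Rightarrow> real^'n \<Rightarrow> complex.
            (\<forall>k. F k \<in> test_functions (- {0}) \<and> (\<exists>x. F k x \<noteq> 0)) \<and>
            (\<lambda>k. (L2_norm (mu_X \<gamma> a) (drift_laplacian \<gamma> a (F k)))\<^sup>2
               / ((real CARD('n))\<^sup>2 * (real CARD('n) - 4)\<^sup>2 / 16
                    * (L2_norm (mu_X \<gamma> a) (\<lambda>x. F k x / complex_of_real ((norm x)\<^sup>2)))\<^sup>2
                  + \<gamma> ^ 4 * b_X a ^ 4 * (L2_norm (mu_X \<gamma> a) (F k))\<^sup>2
                  + \<gamma>\<^sup>2 * (b_X a)\<^sup>2 * ((real CARD('n) - 2)\<^sup>2 / 2)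
                    * (L2_norm (mu_X \<gamma> a) (\<lambda>x. F k x / complex_of_real (norm x)))\<^sup>2))
              \<longlonglongrightarrow> 1)"
proof -
  note o = open_punctured[where 'n='n]
  define m where "m = (real CARD('n) - 4) / 2"
  define \<theta> where "\<theta> = (\<gamma> / 2) *\<^sub>R a"
  have m: "real CARD('n) = 2 * m + 4" "m > 0" and m0: "m \<ge> 0" using assms by (simp_all add: m_def field_simps)
  have c: "\<theta> \<bullet> \<theta> \<ge> 0" by simp
  have energy: "hardy_energy m (\<theta> \<bullet> \<theta>) g \<le> operator_energy (\<theta> \<bullet> \<theta>) g"
    if "g \<in> test_functions (- {0})" for g :: "real^'n \<Rightarrow> real"
    by (rule hardy_rellich_real[OF that m(1) m0 c])
  define G where "G k = (optimizer m (real (Suc k)) :: real^'n \<Rightarrow> real)" for k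
  \<comment> \<open>The inverse of the substitution that removes the weight.\<close>
  define F where "F k x = complex_of_real (G k x * exp ((- \<theta>) \<bullet> x))" for k x
  have F: "F k \<in> test_functions (- {0})" for k
    unfolding F_def G_def
    by (intro test_function_complex_of_real test_function_mult smooth_on_exp_inner optimizer_test_function o) simp
  have nz: "\<exists>x. F k x \<noteq> 0" for k
    using optimizer_nonzero[of "real (Suc k)" m] unfolding F_def G_def by simp
  have Re: "(\<lambda>x. exp (\<theta> \<bullet> x) * Re (F k x)) = G k" and Im: "(\<lambda>x. exp (\<theta> \<bullet> x) * Im (F k x)) = (\<lambda>x. 0)" for k
    by (simp_all add: F_def fun_eq_iff exp_minus power2_eq_square)
  have pd0: "pd i (\<lambda>x::real^'n. 0) = (\<lambda>x. 0)" for i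
    by (intro ext, rule pd_eqI) (rule has_derivative_const)
  have zero: "operator_energy (\<theta> \<bullet> \<theta>) (\<lambda>x::real^'n. 0) = 0" "hardy_energy m (\<theta> \<bullet> \<theta>) (\<lambda>x::real^'n. 0) = 0"
    by (simp_all add: operator_energy_def hardy_energy_def lap_def pd0)
  have lim: "(\<lambda>k. operator_energy (\<theta> \<bullet> \<theta>) (G k) / hardy_energy m (\<theta> \<bullet> \<theta>) (G k)) \<longlonglongrightarrow> 1"
    unfolding G_def by (rule optimizer_quotient_limit[OF m c])
  show ?thesis
  proof (intro conjI ballI exI[of _ F] allI F nz)
    fix f :: "real^'n \<Rightarrow> complex" assume f: "f \<in> test_functions (- {0})"
    note W = weighted_norms_eq_energies[OF f m(1), of \<gamma> a, folded \<theta>_def]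
    show "(real CARD('n))\<^sup>2 * (real CARD('n) - 4)\<^sup>2 / 16
                 * (L2_norm (mu_X \<gamma> a) (\<lambda>x. f x / complex_of_real ((norm x)\<^sup>2)))\<^sup>2
              + \<gamma> ^ 4 * b_X a ^ 4 * (L2_norm (mu_X \<gamma> a) f)\<^sup>2
              + \<gamma>\<^sup>2 * (b_X a)\<^sup>2 * ((real CARD('n) - 2)\<^sup>2 / 2)
                 * (L2_norm (mu_X \<gamma> a) (\<lambda>x. f x / complex_of_real (norm x)))\<^sup>2
          \<le> (L2_norm (mu_X \<gamma> a) (drift_laplacian \<gamma> a f))\<^sup>2"
      unfolding W(3,4) by (intro add_mono energy W(1,2))
  next
    show "(\<lambda>k. (L2_norm (mu_X \<gamma> a) (drift_laplacian \<gamma> a (F k)))\<^sup>2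
               / ((real CARD('n))\<^sup>2 * (real CARD('n) - 4)\<^sup>2 / 16
                    * (L2_norm (mu_X \<gamma> a) (\<lambda>x. F k x / complex_of_real ((norm x)\<^sup>2)))\<^sup>2
                  + \<gamma> ^ 4 * b_X a ^ 4 * (L2_norm (mu_X \<gamma> a) (F k))\<^sup>2
                  + \<gamma>\<^sup>2 * (b_X a)\<^sup>2 * ((real CARD('n) - 2)\<^sup>2 / 2)
                    * (L2_norm (mu_X \<gamma> a) (\<lambda>x. F k x / complex_of_real (norm x)))\<^sup>2))
              \<longlonglongrightarrow> 1"
      using lim
      unfolding weighted_norms_eq_energies(3,4)[OF F m(1), of \<gamma> a, folded \<theta>_def] Re Im zero by simp
  qed
qed

end
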